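(* There is no algorithm which decides, for a given free closed formula $\varphi$, whether there exists an integer $s\ge 1$ such that $\varphi$ holds for matrices of size $s$. In other words, the set $$\{\varphi \mid \varphi \text{ is a free closed formula and there is } s\geq 1 \text{ such that } \varphi \text{ holds for matrices of size } s\}$$ is not recursive (with respect to a standard effective encoding of formulas).
   Context: Let $\mathbb C\langle x_1,\ldots,x_n\rangle$ be the algebra of polynomials in non-commuting variables $x_1,\dots,x_n$, with the involution $*$ uniquely determined by $x_i^*=x_i$ and complex conjugation on $\mathbb C$. The involution is extended to the matrix polynomials $\mathbb M_d(\mathbb C\langle x_1,\ldots,x_n\rangle)$ by transposing and applying $*$ entrywise; a matrix polynomial $p$ is Hermitian if $p^*=p$. Evaluating a Hermitian matrix polynomial $p$ of size $d$ at a tuple $(A_1,\dots,A_n)$ of Hermitian matrices $A_i\in\mathbb M_s(\mathbb C)$ gives a Hermitian matrix of size $ds$ (constant terms are multiplied by the identity matrix). A free formula is a first-order formula built from atomic formulas $p(x_1,\dots,x_n)\geqslant 0$ and $p(x_1,\dots,x_n)>0$, where $p$ is a Hermitian matrix polynomial (of any size $d\ge 1$ and in any number of variables), using Boolean connectives and quantifiers $\exists x_i$, $\forall x_i$. So that formulas are finite objects that can be input to an algorithm, the coefficients of $p$ are taken in $\mathbb Q(i)$. For fixed $s\geq 1$ the formula is interpreted at matrix size $s$: all variables (and all quantifiers) range over the Hermitian complex $s\times s$ matrices, and $\geqslant 0$, $>0$ mean positive semidefinite and positive definite, respectively. (In particular an equation $p=0$ can be expressed by $p\geqslant 0\wedge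 -p\geqslant 0$, and for a non-Hermitian $p$ by $p^*p=0$.) A free closed formula is a free formula without free variables; for each $s\ge 1$ it is either true or false at matrix size $s$. *)

theory Defs
  imports
    "Jordan_Normal_Form.Schur_Decomposition"
    "HOL-Library.Nat_Bijection"
begin

section \<open>Matrix polynomials in non-commuting Hermitian variables\<close>

text \<open>
  The pair \<open>(a, b)\<close> stands for the element \<open>a + b i\<close> of the field of Gaussian rationals.
  A polynomial in the non-commuting variables \<open>x\<^sub>0, x\<^sub>1, \<dots>\<close> is written as a finite list of terms
  (coefficient, word) and stands for their sum. Repeated words and zero coefficients are
  allowed, so the element of the free algebra that is denoted is given by \<open>ncp_coeff\<close>.
  A matrix polynomial is the list of its rows.
\<close>

type_synonym gauss_rat = "rat \<times> rat"
type_synonym ncpoly = "(gauss_rat \<times> nat list) list"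
type_synonym matpoly = "ncpoly list list"

definition gr_complex :: "gauss_rat \<Rightarrow> complex" where
  "gr_complex c = Complex (of_rat (fst c)) (of_rat (snd c))"

definition gr_cnj :: "gauss_rat \<Rightarrow> gauss_rat" where
  "gr_cnj c = (fst c, - snd c)"

definition ncp_coeff :: "ncpoly \<Rightarrow> nat list \<Rightarrow> complex" where
  "ncp_coeff p w = (\<Sum>(c, u)\<leftarrow>p. if u = w then gr_complex c else 0)"

definition ncp_star :: "ncpoly \<Rightarrow> ncpoly" where
  "ncp_star p = map (\<lambda>(c, w). (gr_cnj c, rev w)) p"

definition ncp_vars :: "ncpoly \<Rightarrow> nat set" where
  "ncp_vars p = (\<Union>(c, w)\<in>set p. set w)"

definition square_matpoly :: "matpoly \<Rightarrow> bool" where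
  "square_matpoly p \<longleftrightarrow> length p \<ge> 1 \<and> (\<forall>r\<in>set p. length r = length p)"

definition mp_star :: "matpoly \<Rightarrow> matpoly" where
  "mp_star p = map (\<lambda>i. map (\<lambda>j. ncp_star (p ! j ! i)) [0..<length p]) [0..<length p]"

definition hermitian_matpoly :: "matpoly \<Rightarrow> bool" where
  "hermitian_matpoly p \<longleftrightarrow> square_matpoly p \<and>
     (\<forall>i<length p. \<forall>j<length p. ncp_coeff (mp_star p ! i ! j) = ncp_coeff (p ! i ! j))"

definition mp_vars :: "matpoly \<Rightarrow> nat set" where
  "mp_vars p = (\<Union>r\<in>set p. \<Union>q\<in>set r. ncp_vars q)"

section \<open>Evaluation at Hermitian matrices\<close>

definition herm_mats :: "nat \<Rightarrow> complex mat set" where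
  "herm_mats s = {A \<in> carrier_mat s s. mat_adjoint A = A}"

definition word_eval :: "nat \<Rightarrow> (nat \<Rightarrow> complex mat) \<Rightarrow> nat list \<Rightarrow> complex mat" where
  "word_eval s \<rho> w = foldr (\<lambda>i M. \<rho> i * M) w (1\<^sub>m s)"

definition ncp_eval :: "nat \<Rightarrow> (nat \<Rightarrow> complex mat) \<Rightarrow> ncpoly \<Rightarrow> complex mat" where
  "ncp_eval s \<rho> p = foldr (\<lambda>(c, w) M. gr_complex c \<cdot>\<^sub>m word_eval s \<rho> w + M) p (0\<^sub>m s s)"

text \<open>The \<open>s \<times> s\<close> block in position \<open>(i, j)\<close> is the evaluation of the entry \<open>(i, j)\<close>.\<close>

definition mp_eval :: "nat \<Rightarrow> (nat \<Rightarrow> complex mat) \<Rightarrow> matpoly \<Rightarrow> complex mat" where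
  "mp_eval s \<rho> p = mat (length p * s) (length p * s)
     (\<lambda>(a, b). ncp_eval s \<rho> (p ! (a div s) ! (b div s)) $$ (a mod s, b mod s))"

text \<open>
  The order on complex numbers is that of \<^theory>\<open>HOL-Library.Complex_Order\<close>: \<open>0 \<le> z\<close> says
  that \<open>z\<close> is real and nonnegative.
\<close>

definition pos_semidef :: "complex mat \<Rightarrow> bool" where
  "pos_semidef A \<longleftrightarrow> mat_adjoint A = A \<and> (\<forall>v\<in>carrier_vec (dim_row A). 0 \<le> (A *\<^sub>v v) \<bullet>c v)"

definition pos_def :: "complex mat \<Rightarrow> bool" where
  "pos_def A \<longleftrightarrow> mat_adjoint A = A \<and>
     (\<forall>v\<in>carrier_vec (dim_row A). v \<noteq> 0\<^sub>v (dim_row A) \<longrightarrow> 0 < (A *\<^sub>v v) \<bullet>c v)"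

section \<open>Free formulas\<close>

datatype formula =
    Geq0 matpoly
  | Gt0 matpoly
  | Neg formula
  | Conj formula formula
  | Disj formula formula
  | Exi nat formula
  | All nat formula

fun free_formula :: "formula \<Rightarrow> bool" where
  "free_formula (Geq0 p) = hermitian_matpoly p"
| "free_formula (Gt0 p) = hermitian_matpoly p"
| "free_formula (Neg \<phi>) = free_formula \<phi>"
| "free_formula (Conj \<phi> \<psi>) = (free_formula \<phi> \<and> free_formula \<psi>)"
| "free_formula (Disj \<phi> \<psi>) = (free_formula \<phi> \<and> free_formula \<psi>)"
| "free_formula (Exi i \<phi>) = free_formula \<phi>"
| "free_formula (All i \<phi>) = free_formula \<phi>"

fun fvars :: "formula \<Rightarrow> nat set" where
  "fvars (Geq0 p) = mp_vars p"
| "fvars (Gt0 p) = mp_vars p"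
| "fvars (Neg \<phi>) = fvars \<phi>"
| "fvars (Conj \<phi> \<psi>) = fvars \<phi> \<union> fvars \<psi>"
| "fvars (Disj \<phi> \<psi>) = fvars \<phi> \<union> fvars \<psi>"
| "fvars (Exi i \<phi>) = fvars \<phi> - {i}"
| "fvars (All i \<phi>) = fvars \<phi> - {i}"

definition free_closed_formula :: "formula \<Rightarrow> bool" where
  "free_closed_formula \<phi> \<longleftrightarrow> free_formula \<phi> \<and> fvars \<phi> = {}"

fun sat :: "nat \<Rightarrow> (nat \<Rightarrow> complex mat) \<Rightarrow> formula \<Rightarrow> bool" where
  "sat s \<rho> (Geq0 p) = pos_semidef (mp_eval s \<rho> p)"
| "sat s \<rho> (Gt0 p) = pos_def (mp_eval s \<rho> p)"
| "sat s \<rho> (Neg \<phi>) = (\<not> sat s \<rho> \<phi>)"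
| "sat s \<rho> (Conj \<phi> \<psi>) = (sat s \<rho> \<phi> \<and> sat s \<rho> \<psi>)"
| "sat s \<rho> (Disj \<phi> \<psi>) = (sat s \<rho> \<phi> \<or> sat s \<rho> \<psi>)"
| "sat s \<rho> (Exi i \<phi>) = (\<exists>A\<in>herm_mats s. sat s (\<rho>(i := A)) \<phi>)"
| "sat s \<rho> (All i \<phi>) = (\<forall>A\<in>herm_mats s. sat s (\<rho>(i := A)) \<phi>)"

definition holds_at :: "nat \<Rightarrow> formula \<Rightarrow> bool" where
  "holds_at s \<phi> \<longleftrightarrow> (\<forall>\<rho>. (\<forall>i. \<rho> i \<in> herm_mats s) \<longrightarrow> sat s \<rho> \<phi>)"

text \<open>For formulas without free variables the valuation in \<open>holds_at\<close> plays no role.\<close>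

lemma mp_eval_cong:
  assumes p: "square_matpoly p" and eq: "\<And>i. i \<in> mp_vars p \<Longrightarrow> \<rho> i = \<rho>' i"
  shows "mp_eval s \<rho> p = mp_eval s \<rho>' p"
proof -
  have w: "word_eval s \<rho> w = word_eval s \<rho>' w" if "\<And>i. i \<in> set w \<Longrightarrow> \<rho> i = \<rho>' i" for w
    using that by (induction w) (auto simp: word_eval_def)
  have q: "ncp_eval s \<rho> q = ncp_eval s \<rho>' q" if "\<And>i. i \<in> ncp_vars q \<Longrightarrow> \<rho> i = \<rho>' i" for q
    using that
  proof (induction q)
    case (Cons t q)
    obtain c u where t: "t = (c, u)" by (cases t)
    have "word_eval s \<rho> u = word_eval s \<rho>' u"
      using Cons.prems by (intro w) (force simp: ncp_vars_def t)
    moreover have "ncp_eval s \<rho> q = ncp_eval s \<rho>' q"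
      using Cons.prems by (intro Cons.IH) (force simp: ncp_vars_def)
    ultimately show ?case by (simp add: ncp_eval_def t)
  qed (simp add: ncp_eval_def)
  have "ncp_eval s \<rho> (p ! (a div s) ! (b div s)) = ncp_eval s \<rho>' (p ! (a div s) ! (b div s))"
    if a: "a < length p * s" and b: "b < length p * s" for a b
  proof (rule q)
    have ab: "a div s < length p" "b div s < length p"
      using a b by (auto simp: less_mult_imp_div_less)
    fix i assume i: "i \<in> ncp_vars (p ! (a div s) ! (b div s))"
    have "b div s < length (p ! (a div s))"
      using p ab by (simp add: square_matpoly_def)
    hence "p ! (a div s) ! (b div s) \<in> set (p ! (a div s))" by simp
    with i ab show "\<rho> i = \<rho>' i"
      by (intro eq) (auto simp: mp_vars_def intro!: bexI[of _ "p ! (a div s)"])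
  qed
  thus ?thesis unfolding mp_eval_def by (intro cong_mat) auto
qed

lemma sat_cong:
  assumes "free_formula \<phi>" and "\<And>i. i \<in> fvars \<phi> \<Longrightarrow> \<rho> i = \<rho>' i"
  shows "sat s \<rho> \<phi> = sat s \<rho>' \<phi>"
  using assms
proof (induction \<phi> arbitrary: \<rho> \<rho>')
  case (Geq0 p)
  thus ?case using mp_eval_cong[of p \<rho> \<rho>' s] by (simp add: hermitian_matpoly_def)
next
  case (Gt0 p)
  thus ?case using mp_eval_cong[of p \<rho> \<rho>' s] by (simp add: hermitian_matpoly_def)
next
  case (Neg \<phi>)
  have "sat s \<rho> \<phi> = sat s \<rho>' \<phi>" by (rule Neg.IH) (use Neg.prems in auto)
  thus ?case by simp
next
  case (Conj \<phi> \<psi>)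
  have "sat s \<rho> \<phi> = sat s \<rho>' \<phi>" by (rule Conj.IH(1)) (use Conj.prems in auto)
  moreover have "sat s \<rho> \<psi> = sat s \<rho>' \<psi>" by (rule Conj.IH(2)) (use Conj.prems in auto)
  ultimately show ?case by simp
next
  case (Disj \<phi> \<psi>)
  have "sat s \<rho> \<phi> = sat s \<rho>' \<phi>" by (rule Disj.IH(1)) (use Disj.prems in auto)
  moreover have "sat s \<rho> \<psi> = sat s \<rho>' \<psi>" by (rule Disj.IH(2)) (use Disj.prems in auto)
  ultimately show ?case by simp
next
  case (Exi i \<phi>)
  have "sat s (\<rho>(i := A)) \<phi> = sat s (\<rho>'(i := A)) \<phi>" for A
    by (rule Exi.IH) (use Exi.prems in auto)
  thus ?case by simp
next
  case (All i \<phi>)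
  have "sat s (\<rho>(i := A)) \<phi> = sat s (\<rho>'(i := A)) \<phi>" for A
    by (rule All.IH) (use All.prems in auto)
  thus ?case by simp
qed

section \<open>Encoding of formulas by natural numbers\<close>

definition rat_code :: "rat \<Rightarrow> nat" where
  "rat_code q = (case quotient_of q of (a, b) \<Rightarrow> prod_encode (int_encode a, int_encode b))"

definition gr_code :: "gauss_rat \<Rightarrow> nat" where
  "gr_code c = prod_encode (rat_code (fst c), rat_code (snd c))"

definition ncp_code :: "ncpoly \<Rightarrow> nat" where
  "ncp_code p = list_encode (map (\<lambda>(c, w). prod_encode (gr_code c, list_encode w)) p)"

definition mp_code :: "matpoly \<Rightarrow> nat" where
  "mp_code p = list_encode (map (\<lambda>r. list_encode (map ncp_code r)) p)"

fun formula_code :: "formula \<Rightarrow> nat" where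
  "formula_code (Geq0 p) = prod_encode (0, mp_code p)"
| "formula_code (Gt0 p) = prod_encode (1, mp_code p)"
| "formula_code (Neg \<phi>) = prod_encode (2, formula_code \<phi>)"
| "formula_code (Conj \<phi> \<psi>) = prod_encode (3, prod_encode (formula_code \<phi>, formula_code \<psi>))"
| "formula_code (Disj \<phi> \<psi>) = prod_encode (4, prod_encode (formula_code \<phi>, formula_code \<psi>))"
| "formula_code (Exi i \<phi>) = prod_encode (5, prod_encode (i, formula_code \<phi>))"
| "formula_code (All i \<phi>) = prod_encode (6, prod_encode (i, formula_code \<phi>))"

lemma inj_rat_code: "inj rat_code"
proof (rule injI)
  fix x y assume "rat_code x = rat_code y"
  hence "quotient_of x = quotient_of y"
    by (auto simp: rat_code_def int_encode_eq split: prod.splits)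
  thus "x = y" by (simp add: quotient_of_inject)
qed

lemma inj_gr_code: "inj gr_code"
  using inj_rat_code by (auto intro!: injI simp: gr_code_def inj_eq prod_eq_iff)

lemma inj_ncp_code: "inj ncp_code"
proof -
  have "inj (\<lambda>(c, w). prod_encode (gr_code c, list_encode w))"
    using inj_gr_code by (auto intro!: injI simp: inj_eq list_encode_eq)
  thus ?thesis by (auto intro!: injI simp: ncp_code_def list_encode_eq inj_map_eq_map)
qed

lemma inj_mp_code: "inj mp_code"
proof -
  have "inj (\<lambda>r. list_encode (map ncp_code r))"
    using inj_ncp_code by (auto intro!: injI simp: list_encode_eq inj_map_eq_map)
  thus ?thesis by (auto intro!: injI simp: mp_code_def list_encode_eq inj_map_eq_map)
qed

lemma inj_formula_code: "inj formula_code"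
proof (rule injI)
  fix \<phi> \<psi> show "formula_code \<phi> = formula_code \<psi> \<Longrightarrow> \<phi> = \<psi>"
  proof (induction \<phi> arbitrary: \<psi>)
    case (Geq0 p) thus ?case by (cases \<psi>) (simp_all add: inj_eq[OF inj_mp_code])
  next
    case (Gt0 p) thus ?case by (cases \<psi>) (simp_all add: inj_eq[OF inj_mp_code])
  next
    case (Neg \<phi>) thus ?case by (cases \<psi>) simp_all
  next
    case (Conj \<phi>1 \<phi>2) thus ?case by (cases \<psi>) simp_all
  next
    case (Disj \<phi>1 \<phi>2) thus ?case by (cases \<psi>) simp_all
  next
    case (Exi i \<phi>) thus ?case by (cases \<psi>) simp_all
  next
    case (All i \<phi>) thus ?case by (cases \<psi>) simp_all
  qed
qed

section \<open>Partial recursive functions\<close>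

text \<open>
  Kleene's \<open>\<mu>\<close>-recursive functions. The relation \<open>computes f xs y\<close> says that the program \<open>f\<close> on
  the argument list \<open>xs\<close> terminates with value \<open>y\<close>; the recursion argument of \<open>PrimRec\<close> and the
  argument searched by \<open>Mu\<close> come first.
\<close>

datatype recf =
    Zero
  | Succ
  | Proj nat
  | Comp recf "recf list"
  | PrimRec recf recf
  | Mu recf

inductive computes :: "recf \<Rightarrow> nat list \<Rightarrow> nat \<Rightarrow> bool" where
  zero: "computes Zero xs 0"
| succ: "computes Succ [x] (Suc x)"
| proj: "i < length xs \<Longrightarrow> computes (Proj i) xs (xs ! i)"
| comp: "list_all2 (\<lambda>g y. computes g xs y) gs ys \<Longrightarrow> computes f ys z \<Longrightarrow>
    computes (Comp f gs) xs z"
| primrec_0: "computes g xs y \<Longrightarrow> computes (PrimRec g h) (0 # xs) y"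
| primrec_Suc: "computes (PrimRec g h) (n # xs) r \<Longrightarrow> computes h (n # r # xs) y \<Longrightarrow>
    computes (PrimRec g h) (Suc n # xs) y"
| mu: "computes f (n # xs) 0 \<Longrightarrow> (\<And>m. m < n \<Longrightarrow> \<exists>y. computes f (m # xs) (Suc y)) \<Longrightarrow>
    computes (Mu f) xs n"

lemma computes_functional: "computes f xs y \<Longrightarrow> computes f xs z \<Longrightarrow> y = z"
proof (induction arbitrary: z rule: computes.induct)
  case (comp xs gs ys f z')
  from comp.prems obtain ys' where ys': "list_all2 (\<lambda>g y. computes g xs y) gs ys'"
    and z: "computes f ys' z" by cases auto
  have "ys = ys'" using comp.IH(1) ys'
  proof (induction gs arbitrary: ys ys')
    case (Cons g gs)
    thus ?case by (auto simp: list_all2_Cons1)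
  qed auto
  with z comp.IH(2) show ?case by simp
next
  case (primrec_Suc g h n xs r y)
  from primrec_Suc.prems obtain r' where "computes (PrimRec g h) (n # xs) r'"
    and "computes h (n # r' # xs) z" by cases auto
  with primrec_Suc.IH show ?case by blast
next
  case (mu f n xs)
  from mu.prems have z: "computes f (z # xs) 0"
    and lt: "\<And>m. m < z \<Longrightarrow> \<exists>y. computes f (m # xs) (Suc y)" by (cases; simp)+
  have "\<not> n < z" using lt mu.IH(1) by blast
  moreover have "\<not> z < n" using mu.IH(2) z by blast
  ultimately show ?case by simp
next
  case (primrec_0 g xs y h)
  from primrec_0.prems have "computes g xs z" by cases auto
  thus ?case by (rule primrec_0.IH)
qed (erule computes.cases; simp)+

definition recursive_set :: "nat set \<Rightarrow> bool" where
  "recursive_set A \<longleftrightarrow> (\<exists>f. \<forall>n. computes f [n] (of_bool (n \<in> A)))"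

end

theory Submission
  imports Defs
begin

text \<open>
  The formulas at matrix size $s$ contain a weak second-order logic over the real numbers, with
  quantifiers over finite sets of pairs.
  The real numbers are the scalar matrices, which are definable as the Hermitian matrices that
  commute with all others (\<open>sat_is_scalar\<close>); on them, linear equations are atomic up to Boolean
  combination. A pair of Hermitian matrices $N$, $R$ names the set of all pairs of real eigenvalues
  of a common eigenvector. Membership of $(x, y)$ in this set says that $(N - x)^2 + (R - y)^2$ is not
  positive definite (\<open>sat_mem_spec\<close>). The named sets are finite at every size, and every nonempty
  finite set has a name at all large sizes (\<open>joint_spec_realized\<close>).

  This suffices to express computations. For each partial recursive function there is a formula
  for its graph: existential quantifiers guess finite traces, and universal quantifiers over scalars
  check that each entry of a trace is the start or follows from another entry. The formula can only
  be satisfied by true values, at any matrix size, because finiteness makes the backward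
  justifications end (\<open>graph_formula_sound\<close>). A true value satisfies it as soon as the matrices are large
  enough to hold the traces (\<open>graph_formula_complete\<close>). So a computation terminates with a given value if and
  only if a certain sentence holds at some matrix size.

  Undecidability follows by a diagonal argument on formulas in place of programs. Given a supposed
  decision procedure, let a formula \<open>\<psi>(x)\<close> express that the procedure rejects the sentence that
  arises from the formula with code \<open>x\<close> by supplying \<open>x\<close> as argument. Then \<open>\<psi>\<close>, supplied with
  its own code, holds at some size exactly if the procedure says that it does not. Of the
  encoding this uses only that this kind of instantiation is recursive on codes, which reduces to
  the pairing function; neither a universal program nor an encoding of programs enters.
\<close>

section \<open>Quadratic forms of Hermitian matrices\<close>

lemma mat_adjoint_index:
  assumes "A \<in> carrier_mat s s" "i < s" "j < s"
  shows "mat_adjoint A $$ (i, j) = cnj (A $$ (j, i))"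
  using assms by (auto simp: mat_adjoint_def mat_of_rows_def)

lemma mat_adjoint_carrier [simp]:
  "A \<in> carrier_mat s s \<Longrightarrow> mat_adjoint A \<in> carrier_mat s s"
  by (auto simp: mat_adjoint_def)

lemma herm_mats_iff:
  "A \<in> herm_mats s \<longleftrightarrow>
     A \<in> carrier_mat s s \<and> (\<forall>i<s. \<forall>j<s. A $$ (i, j) = cnj (A $$ (j, i)))"
proof (cases "A \<in> carrier_mat s s")
  case True
  then have "mat_adjoint A = A \<longleftrightarrow> (\<forall>i<s. \<forall>j<s. A $$ (i, j) = mat_adjoint A $$ (i, j))"
    using carrier_matD[OF mat_adjoint_carrier[OF True]] by (metis carrier_matD eq_matI)
  also have "\<dots> \<longleftrightarrow> (\<forall>i<s. \<forall>j<s. A $$ (i, j) = cnj (A $$ (j, i)))"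
    using mat_adjoint_index[OF True] by metis
  finally show ?thesis using True by (simp add: herm_mats_def)
qed (simp add: herm_mats_def)

lemma herm_mats_carrier: "A \<in> herm_mats s \<Longrightarrow> A \<in> carrier_mat s s"
  by (simp add: herm_mats_def)

lemma inner_mult_mat_vec:
  fixes A :: "complex mat"
  assumes A: "A \<in> carrier_mat s s" and v: "v \<in> carrier_vec s" and w: "w \<in> carrier_vec s"
  shows "(A *\<^sub>v v) \<bullet>c w = v \<bullet>c (mat_adjoint A *\<^sub>v w)"
proof -
  note dims = carrier_matD[OF A] carrier_vecD[OF v] carrier_vecD[OF w]
    carrier_matD[OF mat_adjoint_carrier[OF A]]
  have "(A *\<^sub>v v) \<bullet>c w = (\<Sum>i<s. \<Sum>j<s. A $$ (i, j) * v $ j * cnj (w $ i))"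
    using dims by (simp add: scalar_prod_def sum_distrib_right atLeast0LessThan)
  also have "\<dots> = (\<Sum>j<s. \<Sum>i<s. A $$ (i, j) * v $ j * cnj (w $ i))"
    by (rule sum.swap)
  also have "\<dots> = v \<bullet>c (mat_adjoint A *\<^sub>v w)"
    using dims A
    by (simp add: scalar_prod_def sum_distrib_left atLeast0LessThan mat_adjoint_index ac_simps)
  finally show ?thesis .
qed

text \<open>
  A real number $t$ enters the formulas as the scalar matrix $t \cdot 1$. Matrix polynomials then
  compute with real numbers, whatever the matrix size.
\<close>
definition scal :: "nat \<Rightarrow> real \<Rightarrow> complex mat" where
  "scal s t = complex_of_real t \<cdot>\<^sub>m 1\<^sub>m s"

lemma scal_carrier [simp]: "scal s t \<in> carrier_mat s s"
  by (simp add: scal_def)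

lemma scal_dims [simp]: "dim_row (scal s t) = s" "dim_col (scal s t) = s"
  by (simp_all add: scal_def)

lemma scal_index [simp]:
  "i < s \<Longrightarrow> j < s \<Longrightarrow> scal s t $$ (i, j) = (if i = j then complex_of_real t else 0)"
  by (simp add: scal_def)

lemma scal_herm [simp]: "scal s t \<in> herm_mats s"
  by (simp add: herm_mats_iff)

lemma scal_mult_vec: "v \<in> carrier_vec s \<Longrightarrow> scal s t *\<^sub>v v = complex_of_real t \<cdot>\<^sub>v v"
  by (intro eq_vecI) (auto simp: scal_def scalar_prod_def if_distrib if_distribR cong: if_cong)

lemma pos_semidef_scal:
  assumes "s \<ge> 1"
  shows "pos_semidef (scal s t) \<longleftrightarrow> 0 \<le> t"
proof
  assume "pos_semidef (scal s t)"
  then have "0 \<le> (scal s t *\<^sub>v unit_vec s 0) \<bullet>c (unit_vec s 0)"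
    by (auto simp: pos_semidef_def)
  also have "scal s t *\<^sub>v unit_vec s 0 = complex_of_real t \<cdot>\<^sub>v unit_vec s 0"
    by (rule scal_mult_vec) simp
  also have "(complex_of_real t \<cdot>\<^sub>v unit_vec s 0) \<bullet>c (unit_vec s 0) = t"
    using assms by (simp add: scalar_prod_right_unit scalar_prod_def if_distrib if_distribR cong: if_cong)
  finally show "0 \<le> t" by (simp add: less_eq_complex_def)
next
  assume t: "0 \<le> t"
  have "0 \<le> (scal s t *\<^sub>v v) \<bullet>c v" if v: "v \<in> carrier_vec s" for v
  proof -
    have "(scal s t *\<^sub>v v) \<bullet>c v = t * (v \<bullet>c v)"
      using v by (simp add: scal_mult_vec)
    then show ?thesis using t conjugate_square_ge_0_vec[of v]
      by (simp add: less_eq_complex_def)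
  qed
  then show "pos_semidef (scal s t)"
    using scal_herm[of s t] by (simp add: pos_semidef_def herm_mats_def)
qed

lemma pos_def_scal:
  assumes "s \<ge> 1"
  shows "pos_def (scal s t) \<longleftrightarrow> 0 < t"
proof
  assume "pos_def (scal s t)"
  moreover have "unit_vec s 0 \<noteq> (0\<^sub>v s :: complex vec)"
    using assms by (simp add: unit_vec_nonzero)
  ultimately have "0 < (scal s t *\<^sub>v unit_vec s 0) \<bullet>c (unit_vec s 0)"
    by (auto simp: pos_def_def)
  also have "scal s t *\<^sub>v unit_vec s 0 = complex_of_real t \<cdot>\<^sub>v unit_vec s 0"
    by (rule scal_mult_vec) simp
  also have "(complex_of_real t \<cdot>\<^sub>v unit_vec s 0) \<bullet>c (unit_vec s 0) = t"
    using assms by (simp add: scalar_prod_right_unit scalar_prod_def if_distrib if_distribR cong: if_cong)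
  finally show "0 < t" by (simp add: less_complex_def)
next
  assume t: "0 < t"
  have "0 < (scal s t *\<^sub>v v) \<bullet>c v" if v: "v \<in> carrier_vec s" "v \<noteq> 0\<^sub>v s" for v
  proof -
    have "(scal s t *\<^sub>v v) \<bullet>c v = t * (v \<bullet>c v)"
      using v by (simp add: scal_mult_vec)
    then show ?thesis using t conjugate_square_greater_0_vec[OF v(1)] v(2)
      by (simp add: less_complex_def)
  qed
  then show "pos_def (scal s t)"
    using scal_herm[of s t] by (simp add: pos_def_def herm_mats_def)
qed

text \<open>
  Commuting with the diagonal matrix units forces the off-diagonal entries of \<open>X\<close> to vanish, and
  commuting with the all-ones matrix forces the diagonal entries to agree. This makes the copy of the
  real line inside the Hermitian matrices definable by a universal quantifier.
\<close>
lemma central_iff_scal: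
  assumes X: "X \<in> herm_mats s"
  shows "(\<forall>Y\<in>herm_mats s. X * Y = Y * X) \<longleftrightarrow> (\<exists>t. X = scal s t)"
proof
  assume comm: "\<forall>Y\<in>herm_mats s. X * Y = Y * X"
  have Xc: "X \<in> carrier_mat s s" using X by (rule herm_mats_carrier)
  have off: "X $$ (a, b) = 0" if ab: "a < s" "b < s" "a \<noteq> b" for a b
  proof -
    define Y :: "complex mat" where "Y = mat s s (\<lambda>(i, j). if i = b \<and> j = b then 1 else 0)"
    have "Y \<in> herm_mats s" by (auto simp: Y_def herm_mats_iff)
    then have "(X * Y) $$ (a, b) = (Y * X) $$ (a, b)" using comm by simp
    then show ?thesis
      using ab Xc by (simp add: Y_def scalar_prod_def if_distrib if_distribR cong: if_cong)
  qed
  have diag: "X $$ (a, a) = X $$ (b, b)" if ab: "a < s" "b < s" for a b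
  proof -
    define Y :: "complex mat" where "Y = mat s s (\<lambda>(i, j). 1)"
    have "Y \<in> herm_mats s" by (auto simp: Y_def herm_mats_iff)
    then have "(X * Y) $$ (a, b) = (Y * X) $$ (a, b)" using comm by simp
    moreover have "(X * Y) $$ (a, b) = X $$ (a, a)"
    proof -
      have "(X * Y) $$ (a, b) = (\<Sum>k<s. X $$ (a, k))"
        using ab Xc by (simp add: Y_def scalar_prod_def atLeast0LessThan)
      also have "\<dots> = (\<Sum>k\<in>{a}. X $$ (a, k))"
        using ab by (intro sum.mono_neutral_right) (auto intro: off)
      finally show ?thesis by simp
    qed
    moreover have "(Y * X) $$ (a, b) = X $$ (b, b)"
    proof -
      have "(Y * X) $$ (a, b) = (\<Sum>k<s. X $$ (k, b))"
        using ab Xc by (simp add: Y_def scalar_prod_def atLeast0LessThan)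
      also have "\<dots> = (\<Sum>k\<in>{b}. X $$ (k, b))"
        using ab by (intro sum.mono_neutral_right) (auto intro: off)
      finally show ?thesis by simp
    qed
    ultimately show ?thesis by metis
  qed
  have real: "X $$ (a, a) = complex_of_real (Re (X $$ (a, a)))" if "a < s" for a
  proof -
    have "X $$ (a, a) = cnj (X $$ (a, a))" using X that unfolding herm_mats_iff by blast
    then have "Im (X $$ (a, a)) = - Im (X $$ (a, a))" by (metis cnj.simps(2))
    then show ?thesis by (simp add: complex_eq_iff)
  qed
  have "X = scal s (Re (X $$ (0, 0)))"
  proof (rule eq_matI)
    fix i j assume "i < dim_row (scal s (Re (X $$ (0, 0))))" "j < dim_col (scal s (Re (X $$ (0, 0))))"
    then show "X $$ (i, j) = scal s (Re (X $$ (0, 0))) $$ (i, j)"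
      using off[of i j] diag[of i 0] real[of 0] by auto
  qed (use Xc in auto)
  then show "\<exists>t. X = scal s t" by blast
next
  assume "\<exists>t. X = scal s t"
  then obtain t where t: "X = scal s t" ..
  have "X * Y = Y * X" if "Y \<in> herm_mats s" for Y
    using herm_mats_carrier[OF that]
    by (simp add: t scal_def mult_smult_assoc_mat[of _ s s _ s] mult_smult_distrib[of _ s s _ s])
  then show "\<forall>Y\<in>herm_mats s. X * Y = Y * X" by blast
qed

lemma mat_zero_if_mult_vec_zero:
  fixes C :: "complex mat"
  assumes C: "C \<in> carrier_mat s s" and "\<And>v. v \<in> carrier_vec s \<Longrightarrow> C *\<^sub>v v = 0\<^sub>v s"
  shows "C = 0\<^sub>m s s"
proof (rule eq_matI)
  fix i j assume "i < dim_row (0\<^sub>m s s :: complex mat)" "j < dim_col (0\<^sub>m s s :: complex mat)"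
  then have ij: "i < s" "j < s" by simp_all
  have "(C *\<^sub>v unit_vec s j) $ i = C $$ (i, j)"
    using C ij by (simp add: scalar_prod_right_unit)
  then show "C $$ (i, j) = 0\<^sub>m s s $$ (i, j)" using assms(2)[of "unit_vec s j"] ij by simp
qed (use C in auto)

lemma mat_adjoint_mult:
  fixes A :: "complex mat"
  assumes "A \<in> carrier_mat s s" "B \<in> carrier_mat s s"
  shows "mat_adjoint (A * B) = mat_adjoint B * mat_adjoint A"
proof -
  have AB: "A * B \<in> carrier_mat s s" using assms by simp
  have ca: "mat_adjoint A \<in> carrier_mat s s" "mat_adjoint B \<in> carrier_mat s s" using assms by simp_all
  show ?thesis
  proof (rule eq_matI)
    fix i j assume "i < dim_row (mat_adjoint B * mat_adjoint A)" "j < dim_col (mat_adjoint B * mat_adjoint A)"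
    then have ij: "i < s" "j < s" using ca by simp_all
    then show "mat_adjoint (A * B) $$ (i, j) = (mat_adjoint B * mat_adjoint A) $$ (i, j)"
      using assms carrier_matD[OF ca(1)] carrier_matD[OF ca(2)]
      by (simp add: mat_adjoint_index[OF AB] mat_adjoint_index[OF assms(1)]
          mat_adjoint_index[OF assms(2)] scalar_prod_def cnj_sum mult.commute)
  qed (use assms ca carrier_matD[OF mat_adjoint_carrier[OF AB]] carrier_matD[OF ca(1)] carrier_matD[OF ca(2)] in auto)
qed

lemma mat_adjoint_add:
  fixes A :: "complex mat"
  assumes "A \<in> carrier_mat s s" "B \<in> carrier_mat s s"
  shows "mat_adjoint (A + B) = mat_adjoint A + mat_adjoint B"
proof -
  have AB: "A + B \<in> carrier_mat s s" using assms by simp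
  note dims = carrier_matD[OF mat_adjoint_carrier[OF AB]]
    carrier_matD[OF mat_adjoint_carrier[OF assms(1)]]
    carrier_matD[OF mat_adjoint_carrier[OF assms(2)]]
  show ?thesis
    by (rule eq_matI) (use dims assms in \<open>auto simp: mat_adjoint_index[OF AB]
        mat_adjoint_index[OF assms(1)] mat_adjoint_index[OF assms(2)]\<close>)
qed

text \<open>
  The commutator \<open>C\<close> of two Hermitian matrices is skew-Hermitian, so the quadratic form of
  \<open>C\<^sup>2\<close> at \<open>v\<close> is \<open>-\<parallel>C v\<parallel>\<^sup>2\<close>. Hence the equation \<open>X Y = Y X\<close> is
  a single atomic formula in a Hermitian polynomial.
\<close>
lemma pos_semidef_commutator_square:
  assumes X: "X \<in> herm_mats s" and Y: "Y \<in> herm_mats s"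
  defines "C \<equiv> X * Y - Y * X"
  shows "pos_semidef (C * C) \<longleftrightarrow> X * Y = Y * X"
proof -
  have Xc: "X \<in> carrier_mat s s" and Yc: "Y \<in> carrier_mat s s"
    using X Y by (simp_all add: herm_mats_carrier)
  have Cc: "C \<in> carrier_mat s s" using Xc Yc by (auto simp: C_def)
  have adj: "mat_adjoint (X * Y) = Y * X" "mat_adjoint (Y * X) = X * Y"
    using X Y by (simp_all add: mat_adjoint_mult[of _ s] herm_mats_def)
  have skew: "mat_adjoint C = - C"
  proof (rule eq_matI)
    fix i j assume "i < dim_row (- C)" "j < dim_col (- C)"
    then have ij: "i < s" "j < s" using Cc by simp_all
    have XY: "X * Y \<in> carrier_mat s s" "Y * X \<in> carrier_mat s s" using Xc Yc by auto
    have "cnj ((X * Y) $$ (j, i)) = (Y * X) $$ (i, j)"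
      unfolding mat_adjoint_index[OF XY(1) ij, symmetric] adj ..
    moreover have "cnj ((Y * X) $$ (j, i)) = (X * Y) $$ (i, j)"
      unfolding mat_adjoint_index[OF XY(2) ij, symmetric] adj ..
    moreover have "C $$ (k, l) = (X * Y) $$ (k, l) - (Y * X) $$ (k, l)" if "k < s" "l < s" for k l
      using XY that Xc Yc by (simp add: C_def del: index_mult_mat(1))
    ultimately show "mat_adjoint C $$ (i, j) = (- C) $$ (i, j)"
      using Cc ij by (simp add: mat_adjoint_index[OF Cc])
  qed (use Cc carrier_matD[OF mat_adjoint_carrier[OF Cc]] in auto)
  have quad: "((C * C) *\<^sub>v v) \<bullet>c v = - ((C *\<^sub>v v) \<bullet>c (C *\<^sub>v v))" if v: "v \<in> carrier_vec s" for v
  proof -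
    have Cv: "C *\<^sub>v v \<in> carrier_vec s" using Cc v by simp
    have "((C * C) *\<^sub>v v) \<bullet>c v = (C *\<^sub>v (C *\<^sub>v v)) \<bullet>c v" using Cc v by simp
    also have "\<dots> = (C *\<^sub>v v) \<bullet>c (- C *\<^sub>v v)"
      using inner_mult_mat_vec[OF Cc Cv v] skew by simp
    also have "- C *\<^sub>v v = - (C *\<^sub>v v)" using Cc v
      by (intro eq_vecI) auto
    also have "(C *\<^sub>v v) \<bullet>c (- (C *\<^sub>v v)) = - ((C *\<^sub>v v) \<bullet>c (C *\<^sub>v v))"
      using Cv by (simp add: scalar_prod_def sum_negf)
    finally show ?thesis .
  qed
  have "pos_semidef (C * C) \<longleftrightarrow> C = 0\<^sub>m s s"
  proof
    assume psd: "pos_semidef (C * C)"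
    show "C = 0\<^sub>m s s"
    proof (rule mat_zero_if_mult_vec_zero[OF Cc])
      fix v :: "complex vec" assume v: "v \<in> carrier_vec s"
      then have "0 \<le> - ((C *\<^sub>v v) \<bullet>c (C *\<^sub>v v))"
        using psd Cc quad[OF v] by (auto simp: pos_semidef_def)
      moreover have "0 \<le> (C *\<^sub>v v) \<bullet>c (C *\<^sub>v v)" by (rule conjugate_square_ge_0_vec)
      ultimately have "(C *\<^sub>v v) \<bullet>c (C *\<^sub>v v) = 0"
        by (auto simp: less_eq_complex_def complex_eq_iff)
      then show "C *\<^sub>v v = 0\<^sub>v s"
        using conjugate_square_eq_0_vec[of "C *\<^sub>v v" s] Cc v by simp
    qed
  next
    assume "C = 0\<^sub>m s s"
    moreover have "mat_adjoint (0\<^sub>m s s :: complex mat) = 0\<^sub>m s s"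
    proof -
      have "scal s 0 = 0\<^sub>m s s" by (rule eq_matI) auto
      then show ?thesis using scal_herm[of s 0] by (simp add: herm_mats_def)
    qed
    moreover have "0\<^sub>m s s *\<^sub>v v = 0\<^sub>v s" if "v \<in> carrier_vec s" for v :: "complex vec"
      using that by (intro eq_vecI) (auto simp: scalar_prod_def)
    ultimately show "pos_semidef (C * C)" by (auto simp: pos_semidef_def)
  qed
  also have "\<dots> \<longleftrightarrow> X * Y = Y * X"
  proof
    assume C0: "C = 0\<^sub>m s s"
    show "X * Y = Y * X"
    proof (rule eq_matI)
      fix i j assume "i < dim_row (Y * X)" "j < dim_col (Y * X)"
      then have ij: "i < s" "j < s" using Xc Yc by simp_all
      have "C $$ (i, j) = (X * Y) $$ (i, j) - (Y * X) $$ (i, j)"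
        using ij Xc Yc by (simp add: C_def del: index_mult_mat(1))
      then show "(X * Y) $$ (i, j) = (Y * X) $$ (i, j)" using C0 ij by simp
    qed (use Xc Yc in auto)
  next
    assume "X * Y = Y * X"
    then show "C = 0\<^sub>m s s" using Xc Yc by (auto simp: C_def)
  qed
  finally show ?thesis .
qed

text \<open>
  The quadratic form of \<open>A\<^sup>2 + B\<^sup>2\<close> at \<open>v\<close> is
  \<open>\<parallel>A v\<parallel>\<^sup>2 + \<parallel>B v\<parallel>\<^sup>2\<close>, so failure of positive definiteness says
  that \<open>A\<close> and \<open>B\<close> have a common kernel vector.
\<close>
lemma pos_def_sum_squares:
  assumes A: "A \<in> herm_mats s" and B: "B \<in> herm_mats s"
  shows "pos_def (A * A + B * B) \<longleftrightarrow>
     \<not> (\<exists>v\<in>carrier_vec s. v \<noteq> 0\<^sub>v s \<and> A *\<^sub>v v = 0\<^sub>v s \<and> B *\<^sub>v v = 0\<^sub>v s)"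
proof -
  have Ac: "A \<in> carrier_mat s s" and Bc: "B \<in> carrier_mat s s"
    using A B by (simp_all add: herm_mats_carrier)
  have adj: "mat_adjoint (A * A + B * B) = A * A + B * B"
    using A B Ac Bc by (simp add: mat_adjoint_add[of _ s] mat_adjoint_mult[of _ s] herm_mats_def)
  have sq: "((H * H) *\<^sub>v v) \<bullet>c v = (H *\<^sub>v v) \<bullet>c (H *\<^sub>v v)"
    if H: "H \<in> herm_mats s" and v: "v \<in> carrier_vec s" for H v
    using inner_mult_mat_vec[of H s "H *\<^sub>v v" v] H v by (auto simp: herm_mats_def)
  have quad: "((A * A + B * B) *\<^sub>v v) \<bullet>c v
      = (A *\<^sub>v v) \<bullet>c (A *\<^sub>v v) + (B *\<^sub>v v) \<bullet>c (B *\<^sub>v v)" if v: "v \<in> carrier_vec s" for v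
  proof -
    have "(A * A + B * B) *\<^sub>v v = (A * A) *\<^sub>v v + (B * B) *\<^sub>v v"
      using Ac Bc v by (intro add_mult_distrib_mat_vec[of _ s s]) auto
    also have "\<dots> \<bullet>c v = ((A * A) *\<^sub>v v) \<bullet>c v + ((B * B) *\<^sub>v v) \<bullet>c v"
      using Ac Bc v by (intro add_scalar_prod_distrib[of _ s]) auto
    finally show ?thesis using sq[OF A v] sq[OF B v] by simp
  qed
  have pos: "0 < ((A * A + B * B) *\<^sub>v v) \<bullet>c v \<longleftrightarrow> \<not> (A *\<^sub>v v = 0\<^sub>v s \<and> B *\<^sub>v v = 0\<^sub>v s)"
    if v: "v \<in> carrier_vec s" for v
  proof -
    have "A *\<^sub>v v = 0\<^sub>v s \<longleftrightarrow> (A *\<^sub>v v) \<bullet>c (A *\<^sub>v v) = 0"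
      using Ac v by (simp add: conjugate_square_eq_0_vec[of _ s])
    moreover have "B *\<^sub>v v = 0\<^sub>v s \<longleftrightarrow> (B *\<^sub>v v) \<bullet>c (B *\<^sub>v v) = 0"
      using Bc v by (simp add: conjugate_square_eq_0_vec[of _ s])
    moreover have "0 \<le> (A *\<^sub>v v) \<bullet>c (A *\<^sub>v v)" "0 \<le> (B *\<^sub>v v) \<bullet>c (B *\<^sub>v v)"
      by (rule conjugate_square_ge_0_vec)+
    ultimately show ?thesis unfolding quad[OF v]
      by (auto simp: less_eq_complex_def less_complex_def complex_eq_iff)
  qed
  show ?thesis unfolding pos_def_def using Ac Bc adj pos by auto
qed

lemma herm_diff:
  assumes "A \<in> herm_mats s" "B \<in> herm_mats s"
  shows "A - B \<in> herm_mats s"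
  unfolding herm_mats_iff
proof (intro conjI allI impI)
  fix i j assume ij: "i < s" "j < s"
  have "A $$ (i, j) = cnj (A $$ (j, i))" "B $$ (i, j) = cnj (B $$ (j, i))"
    using assms ij unfolding herm_mats_iff by blast+
  moreover have "(A - B) $$ (k, l) = A $$ (k, l) - B $$ (k, l)" if "k < s" "l < s" for k l
    using assms that by (auto simp: herm_mats_def)
  ultimately show "(A - B) $$ (i, j) = cnj ((A - B) $$ (j, i))"
    using ij by (metis complex_cnj_diff)
qed (use assms in \<open>auto simp: herm_mats_def\<close>)

section \<open>Finite sets of pairs as joint spectra\<close>

text \<open>
  The pairs of eigenvalues that belong to a common eigenvector; \<open>A\<close> and \<open>B\<close> need not commute. A
  pair of Hermitian matrices serves as a name for this set of pairs of real numbers. At size \<open>s\<close>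
  the sets with a name are all finite, and include every nonempty set with at most \<open>s\<close> elements.
\<close>
definition joint_spec :: "nat \<Rightarrow> complex mat \<Rightarrow> complex mat \<Rightarrow> (real \<times> real) set" where
  "joint_spec s A B = {(a, b). \<exists>v\<in>carrier_vec s. v \<noteq> 0\<^sub>v s \<and>
     A *\<^sub>v v = complex_of_real a \<cdot>\<^sub>v v \<and> B *\<^sub>v v = complex_of_real b \<cdot>\<^sub>v v}"

lemma finite_real_eigenvalues:
  fixes A :: "complex mat"
  assumes A: "A \<in> carrier_mat s s"
  shows "finite {a::real. eigenvalue A (complex_of_real a)}"
proof -
  have "{a. eigenvalue A (complex_of_real a)} \<subseteq> complex_of_real -` {z. poly (char_poly A) z = 0}"
    using eigenvalue_root_char_poly[OF A] by auto
  moreover have "finite {z. poly (char_poly A) z = 0}"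
    using degree_monic_char_poly[OF A] by (intro poly_roots_finite) auto
  ultimately show ?thesis
    by (meson finite_subset finite_vimageI inj_of_real)
qed

lemma finite_joint_spec:
  assumes "A \<in> carrier_mat s s" "B \<in> carrier_mat s s"
  shows "finite (joint_spec s A B)"
proof (rule finite_subset)
  show "joint_spec s A B \<subseteq> {a. eigenvalue A (complex_of_real a)} \<times> {b. eigenvalue B (complex_of_real b)}"
    using assms by (auto simp: joint_spec_def eigenvalue_def eigenvector_def)
  show "finite ({a. eigenvalue A (complex_of_real a)} \<times> {b. eigenvalue B (complex_of_real b)})"
    using assms by (intro finite_cartesian_product finite_real_eigenvalues)
qed

text \<open>
  List the elements of \<open>P\<close>, with repetition, along the diagonals of two diagonal matrices.
\<close>
lemma joint_spec_realized:
  assumes P: "finite P" "P \<noteq> {}" "card P \<le> s"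
  shows "\<exists>A\<in>herm_mats s. \<exists>B\<in>herm_mats s. joint_spec s A B = P"
proof -
  obtain xs where xs: "set xs = P" "length xs = card P"
    using finite_distinct_list[OF P(1)] distinct_card by metis
  define u where "u i = xs ! (if i < length xs then i else 0)" for i
  have len: "0 < length xs" using P xs by (metis card_gt_0_iff)
  have u: "u ` {..<s} = P"
  proof
    show "u ` {..<s} \<subseteq> P" using len xs(1) by (auto simp: u_def)
    show "P \<subseteq> u ` {..<s}"
    proof
      fix p assume "p \<in> P"
      then obtain i where "i < length xs" "xs ! i = p" using xs by (metis in_set_conv_nth)
      then show "p \<in> u ` {..<s}" using P(3) xs(2) by (intro image_eqI[of _ _ i]) (auto simp: u_def)
    qed
  qed
  define D where "D f = mat s s (\<lambda>(i, j). if i = j then complex_of_real (f i) else 0)"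
    for f :: "nat \<Rightarrow> real"
  have D: "D f \<in> herm_mats s" for f by (auto simp: D_def herm_mats_iff)
  have Dv: "(D f *\<^sub>v v) $ i = complex_of_real (f i) * v $ i" if "v \<in> carrier_vec s" "i < s" for f v i
    using that by (simp add: D_def scalar_prod_def if_distrib if_distribR cong: if_cong)
  have "joint_spec s (D (fst \<circ> u)) (D (snd \<circ> u)) = P"
  proof (intro equalityI subsetI)
    fix p assume "p \<in> joint_spec s (D (fst \<circ> u)) (D (snd \<circ> u))"
    then obtain a b v where p: "p = (a, b)" and v: "v \<in> carrier_vec s" "v \<noteq> 0\<^sub>v s"
      and eq: "D (fst \<circ> u) *\<^sub>v v = complex_of_real a \<cdot>\<^sub>v v" "D (snd \<circ> u) *\<^sub>v v = complex_of_real b \<cdot>\<^sub>v v"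
      by (auto simp: joint_spec_def)
    obtain i where i: "i < s" "v $ i \<noteq> 0"
      using v by (metis carrier_vecD eq_vecI index_zero_vec(1) index_zero_vec(2))
    have "complex_of_real (fst (u i)) * v $ i = complex_of_real a * v $ i"
      "complex_of_real (snd (u i)) * v $ i = complex_of_real b * v $ i"
      using Dv[OF v(1) i(1), of "fst \<circ> u"] Dv[OF v(1) i(1), of "snd \<circ> u"] v i eq by simp_all
    then have "u i = p" using i by (simp add: p prod_eq_iff)
    then show "p \<in> P" using u i by auto
  next
    fix p assume "p \<in> P"
    then obtain i where i: "i < s" "u i = p" using u by auto
    obtain a b where p: "p = (a, b)" by (cases p)
    have "D (fst \<circ> u) *\<^sub>v unit_vec s i = complex_of_real a \<cdot>\<^sub>v unit_vec s i"
      by (rule eq_vecI) (use i p D in \<open>auto simp: Dv unit_vec_def herm_mats_def simp del: index_mult_mat_vec\<close>)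
    moreover have "D (snd \<circ> u) *\<^sub>v unit_vec s i = complex_of_real b \<cdot>\<^sub>v unit_vec s i"
      by (rule eq_vecI) (use i p D in \<open>auto simp: Dv unit_vec_def herm_mats_def simp del: index_mult_mat_vec\<close>)
    moreover have "unit_vec s i \<noteq> (0\<^sub>v s :: complex vec)" using i by (simp add: unit_vec_nonzero)
    ultimately show "p \<in> joint_spec s (D (fst \<circ> u)) (D (snd \<circ> u))"
      unfolding joint_spec_def p by (auto intro!: bexI[of _ "unit_vec s i"])
  qed
  then show ?thesis using D by blast
qed

section \<open>Scalars and finite sets in free formulas\<close>

text \<open>
  A formula may be evaluated at valuations that carry arbitrary values at variables it does not
  mention; requiring Hermitian values everywhere makes all evaluations well-formed at once.
\<close>
definition herm_val :: "nat \<Rightarrow> (nat \<Rightarrow> complex mat) \<Rightarrow> bool" where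
  "herm_val s \<rho> \<longleftrightarrow> (\<forall>i. \<rho> i \<in> herm_mats s)"

lemma herm_valD: "herm_val s \<rho> \<Longrightarrow> \<rho> i \<in> herm_mats s"
  by (simp add: herm_val_def)

lemma herm_val_carrier: "herm_val s \<rho> \<Longrightarrow> \<rho> i \<in> carrier_mat s s"
  by (simp add: herm_val_def herm_mats_def)

lemma herm_val_upd [simp]: "herm_val s \<rho> \<Longrightarrow> A \<in> herm_mats s \<Longrightarrow> herm_val s (\<rho>(i := A))"
  by (simp add: herm_val_def)

lemma word_eval_carrier: "herm_val s \<rho> \<Longrightarrow> word_eval s \<rho> w \<in> carrier_mat s s"
  by (induction w) (auto simp: word_eval_def intro: mult_carrier_mat herm_val_carrier)

lemma ncp_eval_carrier: "herm_val s \<rho> \<Longrightarrow> ncp_eval s \<rho> p \<in> carrier_mat s s"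
  by (induction p) (auto simp: ncp_eval_def)

lemma ncp_eval_index:
  assumes "herm_val s \<rho>" "i < s" "j < s"
  shows "ncp_eval s \<rho> p $$ (i, j) = (\<Sum>(c, w)\<leftarrow>p. gr_complex c * word_eval s \<rho> w $$ (i, j))"
proof (induction p)
  case (Cons t p)
  obtain c w where t: "t = (c, w)" by (cases t)
  have "ncp_eval s \<rho> (t # p) = gr_complex c \<cdot>\<^sub>m word_eval s \<rho> w + ncp_eval s \<rho> p"
    by (simp add: ncp_eval_def t)
  then show ?case
    using Cons assms word_eval_carrier[OF assms(1), of w] ncp_eval_carrier[OF assms(1), of p]
    by (simp add: t)
qed (use assms in \<open>simp add: ncp_eval_def\<close>)

lemma mp_eval_single:
  assumes "herm_val s \<rho>"
  shows "mp_eval s \<rho> [[p]] = ncp_eval s \<rho> p"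
  by (rule eq_matI) (use ncp_eval_carrier[OF assms, of p] in \<open>auto simp: mp_eval_def\<close>)

lemma word_eval_Nil: "word_eval s \<rho> [] = 1\<^sub>m s"
  by (simp add: word_eval_def)

lemma word_eval_single: "herm_val s \<rho> \<Longrightarrow> word_eval s \<rho> [i] = \<rho> i"
  using herm_val_carrier[of s \<rho> i] by (simp add: word_eval_def)

lemma word_eval_Cons: "word_eval s \<rho> (i # w) = \<rho> i * word_eval s \<rho> w"
  by (simp add: word_eval_def)

lemma square_diff_index:
  fixes P Q :: "complex mat"
  assumes "P \<in> carrier_mat s s" "Q \<in> carrier_mat s s" "i < s" "j < s"
  shows "((P - Q) * (P - Q)) $$ (i, j) =
     (P * P) $$ (i, j) - (P * Q) $$ (i, j) - (Q * P) $$ (i, j) + (Q * Q) $$ (i, j)"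
  using assms by (simp add: scalar_prod_def algebra_simps sum.distrib sum_subtractf)

lemma hermitian_single:
  "hermitian_matpoly [[p]] \<longleftrightarrow> ncp_coeff (ncp_star p) = ncp_coeff p"
  by (simp add: hermitian_matpoly_def square_matpoly_def mp_star_def)

text \<open>
  For a \<open>p\<close> that takes a scalar value, being nonnegative but not positive means being zero. This
  expresses an equation with one polynomial, whose code is then easy to compute.
\<close>
definition eq0 :: "ncpoly \<Rightarrow> formula" where
  "eq0 p = Conj (Geq0 [[p]]) (Neg (Gt0 [[p]]))"

lemma sat_eq0:
  assumes "s \<ge> 1" "herm_val s \<rho>" "ncp_eval s \<rho> p = scal s t"
  shows "sat s \<rho> (eq0 p) \<longleftrightarrow> t = 0"
  using assms by (auto simp: eq0_def mp_eval_single pos_semidef_scal pos_def_scal)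

definition num_eq :: "nat \<Rightarrow> nat \<Rightarrow> formula" where
  "num_eq n x = eq0 [((of_nat n, 0), []), ((-1, 0), [x])]"

definition offset_eq :: "nat \<Rightarrow> nat \<Rightarrow> nat \<Rightarrow> formula" where
  "offset_eq n x y = eq0 [((of_nat n, 0), []), ((1, 0), [x]), ((-1, 0), [y])]"

lemma gr_complex_simps:
  "gr_complex (of_nat n, 0) = of_nat n" "gr_complex (1, 0) = 1" "gr_complex (-1, 0) = -1"
  by (simp_all add: gr_complex_def complex_eq_iff)

lemma sat_num_eq:
  assumes "s \<ge> 1" "herm_val s \<rho>" "\<rho> x = scal s a"
  shows "sat s \<rho> (num_eq n x) \<longleftrightarrow> a = n"
proof -
  have "ncp_eval s \<rho> [((of_nat n, 0), []), ((-1, 0), [x])] = scal s (n - a)"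
    by (rule eq_matI)
      (use assms ncp_eval_carrier[OF assms(2), of "[((of_nat n, 0), []), ((-1, 0), [x])]"] in
        \<open>auto simp: ncp_eval_index word_eval_Nil word_eval_single gr_complex_simps\<close>)
  then show ?thesis using assms sat_eq0[of s \<rho> _ "n - a"] by (auto simp: num_eq_def)
qed

lemma sat_offset_eq:
  assumes "s \<ge> 1" "herm_val s \<rho>" "\<rho> x = scal s a" "\<rho> y = scal s b"
  shows "sat s \<rho> (offset_eq n x y) \<longleftrightarrow> b = n + a"
proof -
  have "ncp_eval s \<rho> [((of_nat n, 0), []), ((1, 0), [x]), ((-1, 0), [y])] = scal s (n + a - b)"
    by (rule eq_matI)
      (use assms ncp_eval_carrier[OF assms(2), of "[((of_nat n, 0), []), ((1, 0), [x]), ((-1, 0), [y])]"] in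
        \<open>auto simp: ncp_eval_index word_eval_Nil word_eval_single gr_complex_simps\<close>)
  then show ?thesis using assms sat_eq0[of s \<rho> _ "n + a - b"] by (auto simp: offset_eq_def)
qed

lemma free_num_eq [simp]: "free_formula (num_eq n x)" "fvars (num_eq n x) = {x}"
  by (auto simp: num_eq_def eq0_def hermitian_single ncp_star_def gr_cnj_def mp_vars_def ncp_vars_def)

lemma free_offset_eq [simp]: "free_formula (offset_eq n x y)" "fvars (offset_eq n x y) = {x, y}"
  by (auto simp: offset_eq_def eq0_def hermitian_single ncp_star_def gr_cnj_def mp_vars_def ncp_vars_def)

text \<open>
  The polynomial is the expanded square of the commutator $xy - yx$.
\<close>
definition is_scalar :: "nat \<Rightarrow> formula" where
  "is_scalar x = (let y = Suc x in All y (Geq0 [[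
     [((1, 0), [x, y, x, y]), ((-1, 0), [x, y, y, x]), ((-1, 0), [y, x, x, y]), ((1, 0), [y, x, y, x])]]]))"

lemma free_is_scalar [simp]: "free_formula (is_scalar x)" "fvars (is_scalar x) = {x}"
  by (auto simp: is_scalar_def Let_def hermitian_single ncp_star_def gr_cnj_def mp_vars_def
      ncp_vars_def ncp_coeff_def fun_eq_iff)

lemma sat_is_scalar:
  assumes "herm_val s \<rho>"
  shows "sat s \<rho> (is_scalar x) \<longleftrightarrow> (\<exists>t. \<rho> x = scal s t)"
proof -
  let ?p = "[((1, 0), [x, Suc x, x, Suc x]), ((-1, 0), [x, Suc x, Suc x, x]),
     ((-1, 0), [Suc x, x, x, Suc x]), ((1, 0), [Suc x, x, Suc x, x])] :: ncpoly"
  let ?X = "\<rho> x"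
  have X: "?X \<in> herm_mats s" "?X \<in> carrier_mat s s"
    using assms by (simp_all add: herm_valD herm_val_carrier)
  have "ncp_eval s (\<rho>(Suc x := Y)) ?p = (?X * Y - Y * ?X) * (?X * Y - Y * ?X)"
    if Y: "Y \<in> herm_mats s" for Y
  proof -
    have hv: "herm_val s (\<rho>(Suc x := Y))" using assms Y by simp
    have Yc: "Y \<in> carrier_mat s s" using Y by (rule herm_mats_carrier)
    have assoc: "A * (B * (C * D)) = (A * B) * (C * D)"
      if "A \<in> carrier_mat s s" "B \<in> carrier_mat s s" "C \<in> carrier_mat s s" "D \<in> carrier_mat s s"
      for A B C D :: "complex mat"
      using that by (metis assoc_mult_mat mult_carrier_mat)
    have w: "word_eval s (\<rho>(Suc x := Y)) [a, b, c, d] =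
      ((\<rho>(Suc x := Y)) a * (\<rho>(Suc x := Y)) b) * ((\<rho>(Suc x := Y)) c * (\<rho>(Suc x := Y)) d)" for a b c d
      using assoc[OF herm_val_carrier[OF hv] herm_val_carrier[OF hv] herm_val_carrier[OF hv] herm_val_carrier[OF hv]]
      by (simp only: word_eval_Cons[of _ _ _ "_ # _"] word_eval_single[OF hv])
    show ?thesis
    proof (rule eq_matI)
      fix i j assume "i < dim_row ((?X * Y - Y * ?X) * (?X * Y - Y * ?X))"
        "j < dim_col ((?X * Y - Y * ?X) * (?X * Y - Y * ?X))"
      then have ij: "i < s" "j < s" using X Yc by simp_all
      show "ncp_eval s (\<rho>(Suc x := Y)) ?p $$ (i, j) =
          ((?X * Y - Y * ?X) * (?X * Y - Y * ?X)) $$ (i, j)"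
        using ij X(2) Yc
        by (subst square_diff_index[of _ s])
          (auto simp: ncp_eval_index[OF hv ij] w gr_complex_simps simp del: index_mult_mat assoc_mult_mat)
    qed (use ncp_eval_carrier[OF hv, of ?p] X Yc in auto)
  qed
  then have "sat s \<rho> (is_scalar x) \<longleftrightarrow> (\<forall>Y\<in>herm_mats s. ?X * Y = Y * ?X)"
    using assms X pos_semidef_commutator_square[OF X(1)]
    by (simp add: is_scalar_def Let_def mp_eval_single)
  then show ?thesis using central_iff_scal[OF X(1)] by simp
qed

definition ex_scal :: "nat \<Rightarrow> formula \<Rightarrow> formula" where
  "ex_scal x \<phi> = Exi x (Conj (is_scalar x) \<phi>)"

definition all_scal :: "nat \<Rightarrow> formula \<Rightarrow> formula" where
  "all_scal x \<phi> = All x (Disj (Neg (is_scalar x)) \<phi>)"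

lemma sat_ex_scal:
  "herm_val s \<rho> \<Longrightarrow> sat s \<rho> (ex_scal x \<phi>) \<longleftrightarrow> (\<exists>t. sat s (\<rho>(x := scal s t)) \<phi>)"
  by (auto simp: ex_scal_def sat_is_scalar intro: scal_herm)

lemma sat_all_scal:
  "herm_val s \<rho> \<Longrightarrow> sat s \<rho> (all_scal x \<phi>) \<longleftrightarrow> (\<forall>t. sat s (\<rho>(x := scal s t)) \<phi>)"
  by (auto simp: all_scal_def sat_is_scalar intro: scal_herm)

lemma free_quant_scal [simp]:
  "free_formula (ex_scal x \<phi>) \<longleftrightarrow> free_formula \<phi>" "fvars (ex_scal x \<phi>) = fvars \<phi> - {x}"
  "free_formula (all_scal x \<phi>) \<longleftrightarrow> free_formula \<phi>" "fvars (all_scal x \<phi>) = fvars \<phi> - {x}"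
  by (auto simp: ex_scal_def all_scal_def)

text \<open>
  The polynomial is $(N - x)^2 + (R - y)^2$, expanded.
\<close>
definition mem_spec :: "nat \<Rightarrow> nat \<Rightarrow> nat \<Rightarrow> nat \<Rightarrow> formula" where
  "mem_spec x y N R = Neg (Gt0 [[
     [((1, 0), [N, N]), ((-1, 0), [N, x]), ((-1, 0), [x, N]), ((1, 0), [x, x]),
      ((1, 0), [R, R]), ((-1, 0), [R, y]), ((-1, 0), [y, R]), ((1, 0), [y, y])]]])"

lemma free_mem_spec [simp]:
  "free_formula (mem_spec x y N R)" "fvars (mem_spec x y N R) = {x, y, N, R}"
  by (auto simp: mem_spec_def hermitian_single ncp_star_def gr_cnj_def mp_vars_def
      ncp_vars_def ncp_coeff_def fun_eq_iff)

lemma sat_mem_spec: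
  assumes hv: "herm_val s \<rho>" and ab: "\<rho> x = scal s a" "\<rho> y = scal s b"
  shows "sat s \<rho> (mem_spec x y N R) \<longleftrightarrow> (a, b) \<in> joint_spec s (\<rho> N) (\<rho> R)"
proof -
  let ?p = "[((1, 0), [N, N]), ((-1, 0), [N, x]), ((-1, 0), [x, N]), ((1, 0), [x, x]),
      ((1, 0), [R, R]), ((-1, 0), [R, y]), ((-1, 0), [y, R]), ((1, 0), [y, y])] :: ncpoly"
  define A where "A = \<rho> N - scal s a"
  define B where "B = \<rho> R - scal s b"
  have c: "\<rho> N \<in> carrier_mat s s" "\<rho> R \<in> carrier_mat s s" using hv by (simp_all add: herm_val_carrier)
  have A: "A \<in> herm_mats s" and B: "B \<in> herm_mats s"
    using hv by (simp_all add: A_def B_def herm_diff herm_valD)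
  have "ncp_eval s \<rho> ?p = A * A + B * B"
  proof (rule eq_matI)
    fix i j assume "i < dim_row (A * A + B * B)" "j < dim_col (A * A + B * B)"
    then have ij: "i < s" "j < s" using B by (auto simp: herm_mats_def)
    have "(A * A + B * B) $$ (i, j) = (A * A) $$ (i, j) + (B * B) $$ (i, j)"
      using ij A B by (auto simp: herm_mats_def simp del: index_mult_mat(1))
    also have "(A * A) $$ (i, j) = (\<rho> N * \<rho> N) $$ (i, j) - (\<rho> N * \<rho> x) $$ (i, j)
        - (\<rho> x * \<rho> N) $$ (i, j) + (\<rho> x * \<rho> x) $$ (i, j)"
      unfolding A_def ab by (rule square_diff_index) (use c ij in auto)
    also have "(B * B) $$ (i, j) = (\<rho> R * \<rho> R) $$ (i, j) - (\<rho> R * \<rho> y) $$ (i, j)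
        - (\<rho> y * \<rho> R) $$ (i, j) + (\<rho> y * \<rho> y) $$ (i, j)"
      unfolding B_def ab by (rule square_diff_index) (use c ij in auto)
    finally show "ncp_eval s \<rho> ?p $$ (i, j) = (A * A + B * B) $$ (i, j)"
      by (simp add: ncp_eval_index[OF hv ij] word_eval_Cons[of s \<rho> _ "[_]"] word_eval_single[OF hv]
          gr_complex_simps del: index_mult_mat)
  qed (use ncp_eval_carrier[OF hv, of ?p] A B in \<open>auto simp: herm_mats_def\<close>)
  then have sat: "sat s \<rho> (mem_spec x y N R) \<longleftrightarrow> \<not> pos_def (A * A + B * B)"
    using hv by (simp add: mem_spec_def mp_eval_single)
  have kernel: "(H - scal s t) *\<^sub>v v = 0\<^sub>v s \<longleftrightarrow> H *\<^sub>v v = complex_of_real t \<cdot>\<^sub>v v"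
    if H: "H \<in> carrier_mat s s" and v: "v \<in> carrier_vec s" for H t v
  proof -
    have "(H - scal s t) *\<^sub>v v = H *\<^sub>v v - complex_of_real t \<cdot>\<^sub>v v"
      using H v by (simp add: minus_mult_distrib_mat_vec[of _ s s] scal_mult_vec)
    moreover have "u - w = 0\<^sub>v s \<longleftrightarrow> u = w" if "u \<in> carrier_vec s" "w \<in> carrier_vec s" for u w :: "complex vec"
      using that by (auto simp: vec_eq_iff)
    ultimately show ?thesis using H v by simp
  qed
  show ?thesis
    unfolding sat pos_def_sum_squares[OF A B] joint_spec_def
    by (auto simp: A_def B_def kernel[OF c(1)] kernel[OF c(2)])
qed

section \<open>Computation traces\<close>

definition falsum :: "nat \<Rightarrow> formula" where
  "falsum x = Conj (num_eq 0 x) (Neg (num_eq 0 x))"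

lemma sat_falsum [simp]: "\<not> sat s \<rho> (falsum x)"
  by (simp add: falsum_def)

lemma free_falsum [simp]: "free_formula (falsum x)" "fvars (falsum x) = {x}"
  by (simp_all add: falsum_def)

text \<open>
  Let $P$ be the finite set of pairs named by \<open>N\<close> and \<open>R\<close>. The formula says that \<open>(x, y)\<close> lies in
  $P$ and that every $(i, r)$ in $P$ is justified: either $i = 0$ and \<open>B r\<close> holds, or $P$ contains
  some $(i - 1, r')$ with \<open>S (i - 1) r' r\<close>. Justifications lead backwards so that
  nothing else has to be demanded of $P$: by finiteness every descent along them ends, which can only
  happen at $i = 0$.

  In this and the following formulas the variables from \<open>n\<close> on are fresh and may be bound. The last
  argument of \<open>B\<close> and \<open>S\<close> is the first variable that is fresh for them.
\<close>
definition chain :: "nat \<Rightarrow> nat \<Rightarrow> nat \<Rightarrow> (nat \<Rightarrow> nat \<Rightarrow> formula) \<Rightarrow>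
    (nat \<Rightarrow> nat \<Rightarrow> nat \<Rightarrow> nat \<Rightarrow> formula) \<Rightarrow> formula" where
  "chain x y n B S = (let N = n; R = n + 1; i = n + 2; r = n + 3; i' = n + 4; r' = n + 5 in
     Exi N (Exi R (Conj (mem_spec x y N R)
       (all_scal i (all_scal r (Disj (Neg (mem_spec i r N R))
         (Disj (Conj (num_eq 0 i) (B r (n + 6)))
            (ex_scal i' (ex_scal r' (Conj (mem_spec i' r' N R)
              (Conj (offset_eq 1 i' i) (S i' r' r (n + 6)))))))))))))"

lemma free_chain:
  assumes "\<And>r m. free_formula (B r m) \<and> fvars (B r m) \<subseteq> V \<union> {r}"
    and "\<And>i' r' r m. free_formula (S i' r' r m) \<and> fvars (S i' r' r m) \<subseteq> V \<union> {i', r', r}"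
  shows "free_formula (chain x y n B S) \<and> fvars (chain x y n B S) \<subseteq> V \<union> {x, y}"
  using assms(1)[of "n + 3" "n + 6"] assms(2)[of "n + 4" "n + 5" "n + 3" "n + 6"]
  by (auto simp: chain_def Let_def)

text \<open>
  Every element of \<open>P\<close> is at 0 or has an element of \<open>P\<close> one step below it. As \<open>P\<close> is finite, the
  descent ends, and it can only end at 0.
\<close>
lemma finite_descent:
  fixes P :: "(real \<times> 'a) set"
  assumes "finite P" "p \<in> P"
    and desc: "\<And>a b. (a, b) \<in> P \<Longrightarrow> a = 0 \<and> Q 0 b \<or>
      (\<exists>a' b'. (a', b') \<in> P \<and> a = a' + 1 \<and> (\<forall>k. a' = real k \<longrightarrow> Q k b' \<longrightarrow> Q (Suc k) b))"
  shows "\<exists>k. fst p = real k \<and> Q k (snd p)"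
  using \<open>p \<in> P\<close>
proof (induction "card {q \<in> P. fst q < fst p}" arbitrary: p rule: less_induct)
  case less
  obtain a b where p: "p = (a, b)" by (cases p)
  from desc[of a b] less.prems p consider "a = 0" "Q 0 b" | a' b' where "(a', b') \<in> P" "a = a' + 1"
    "\<And>k. a' = real k \<Longrightarrow> Q k b' \<Longrightarrow> Q (Suc k) b"
    by blast
  then show ?case
  proof cases
    case 1
    then show ?thesis by (auto simp: p intro: exI[of _ 0])
  next
    case 2
    have "{q \<in> P. fst q < a'} \<subset> {q \<in> P. fst q < a}" using 2 by force
    then have "card {q \<in> P. fst q < fst (a', b')} < card {q \<in> P. fst q < fst p}"
      using \<open>finite P\<close> by (simp add: p psubset_card_mono)
    from less.hyps[OF this 2(1)] obtain k where "a' = real k" "Q k b'" by auto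
    then show ?thesis using 2 by (auto simp: p intro!: exI[of _ "Suc k"])
  qed
qed

text \<open>
  \<open>Q\<close> is an invariant that justifications propagate. The valuations at which \<open>B\<close> and \<open>S\<close> are
  evaluated are only known up to the fresh variables.
\<close>
lemma chain_sound:
  assumes s: "s \<ge> 1" and hv: "herm_val s \<rho>" and xy: "x < n" "y < n" "\<rho> x = scal s a" "\<rho> y = scal s b"
    and sat: "sat s \<rho> (chain x y n B S)"
    and base: "\<And>\<rho>' r t m. herm_val s \<rho>' \<Longrightarrow> \<forall>i<n. \<rho>' i = \<rho> i \<Longrightarrow> n \<le> m \<Longrightarrow> r < m \<Longrightarrow>
      \<rho>' r = scal s t \<Longrightarrow> sat s \<rho>' (B r m) \<Longrightarrow> Q 0 t"
    and step: "\<And>\<rho>' i' r' r k t' t m. herm_val s \<rho>' \<Longrightarrow> \<forall>i<n. \<rho>' i = \<rho> i \<Longrightarrow> n \<le> m \<Longrightarrow>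
      i' < m \<Longrightarrow> r' < m \<Longrightarrow> r < m \<Longrightarrow>
      \<rho>' i' = scal s (real k) \<Longrightarrow> \<rho>' r' = scal s t' \<Longrightarrow> \<rho>' r = scal s t \<Longrightarrow>
      sat s \<rho>' (S i' r' r m) \<Longrightarrow> Q k t' \<Longrightarrow> Q (Suc k) t"
  shows "\<exists>k. a = real k \<and> Q k b"
proof -
  from sat obtain M L where herm: "M \<in> herm_mats s" "L \<in> herm_mats s"
    and mem: "sat s (\<rho>(n := M, n + 1 := L)) (mem_spec x y n (n + 1))"
    and all: "sat s (\<rho>(n := M, n + 1 := L)) (all_scal (n + 2) (all_scal (n + 3) (Disj (Neg (mem_spec (n + 2) (n + 3) n (n + 1)))
         (Disj (Conj (num_eq 0 (n + 2)) (B (n + 3) (n + 6)))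
            (ex_scal (n + 4) (ex_scal (n + 5) (Conj (mem_spec (n + 4) (n + 5) n (n + 1))
              (Conj (offset_eq 1 (n + 4) (n + 2)) (S (n + 4) (n + 5) (n + 3) (n + 6))))))))))"
    by (auto simp: chain_def Let_def)
  let ?P = "joint_spec s M L"
  let ?\<sigma> = "\<lambda>i r. \<rho>(n := M, n + 1 := L, n + 2 := scal s i, n + 3 := scal s r)"
  let ?\<tau> = "\<lambda>i r i' r'. (?\<sigma> i r)(n + 4 := scal s i', n + 5 := scal s r')"
  have hv1: "herm_val s (\<rho>(n := M, n + 1 := L))" using hv herm by simp
  have hv2: "herm_val s (?\<sigma> i r)" for i r using hv1 by simp
  have hv3: "herm_val s (?\<tau> i r i' r')" for i r i' r' using hv2 by simp
  have "(a, b) \<in> ?P" using mem sat_mem_spec[OF hv1, of x a y b n "n + 1"] xy by simp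
  moreover have "finite ?P" using herm by (intro finite_joint_spec herm_mats_carrier)
  moreover have "i = 0 \<and> Q 0 r \<or> (\<exists>i' r'. (i', r') \<in> ?P \<and> i = i' + 1 \<and>
      (\<forall>k. i' = real k \<longrightarrow> Q k r' \<longrightarrow> Q (Suc k) r))" if ir: "(i, r) \<in> ?P" for i r
  proof -
    have "sat s (?\<sigma> i r) (mem_spec (n + 2) (n + 3) n (n + 1))"
      using sat_mem_spec[OF hv2, of i r "n + 2" i "n + 3" r n "n + 1"] ir by simp
    with all have "sat s (?\<sigma> i r) (Disj (Conj (num_eq 0 (n + 2)) (B (n + 3) (n + 6)))
            (ex_scal (n + 4) (ex_scal (n + 5) (Conj (mem_spec (n + 4) (n + 5) n (n + 1))
              (Conj (offset_eq 1 (n + 4) (n + 2)) (S (n + 4) (n + 5) (n + 3) (n + 6)))))))"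
      using hv1 by (simp add: sat_all_scal)
    then consider "sat s (?\<sigma> i r) (num_eq 0 (n + 2))" "sat s (?\<sigma> i r) (B (n + 3) (n + 6))"
      | i' r' where "sat s (?\<tau> i r i' r') (mem_spec (n + 4) (n + 5) n (n + 1))"
          "sat s (?\<tau> i r i' r') (offset_eq 1 (n + 4) (n + 2))"
          "sat s (?\<tau> i r i' r') (S (n + 4) (n + 5) (n + 3) (n + 6))"
      using hv2 by (auto simp: sat_ex_scal)
    then show ?thesis
    proof cases
      case 1
      have "i = 0" using 1(1) sat_num_eq[OF s hv2, of i r "n + 2" i 0] by simp
      moreover have "Q 0 r" by (rule base[OF hv2 _ _ _ _ 1(2)]) auto
      ultimately show ?thesis by simp
    next
      case 2
      have "(i', r') \<in> ?P"
        using 2(1) sat_mem_spec[OF hv3, of i r i' r' "n + 4" i' "n + 5" r' n "n + 1"] by simp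
      moreover have "i = i' + 1"
        using 2(2) sat_offset_eq[OF s hv3, of i r i' r' "n + 4" i' "n + 2" i 1] by simp
      moreover have "Q (Suc k) r" if "i' = real k" "Q k r'" for k
        by (rule step[OF hv3 _ _ _ _ _ _ _ _ 2(3)]) (use that in auto)
      ultimately show ?thesis by blast
    qed
  qed
  ultimately show ?thesis using finite_descent[of ?P "(a, b)" Q] by simp
qed

text \<open>
  The trace of the computation has \<open>k + 1\<close> pairs, which is why the matrix size has to exceed \<open>k\<close>.
\<close>
lemma chain_complete:
  assumes s: "s \<ge> 1" and hv: "herm_val s \<rho>" and k: "k < s"
    and xy: "x < n" "y < n" "\<rho> x = scal s (real k)" "\<rho> y = scal s (real (f k))"
    and base: "\<And>\<rho>' r m. herm_val s \<rho>' \<Longrightarrow> \<forall>i<n. \<rho>' i = \<rho> i \<Longrightarrow> n \<le> m \<Longrightarrow> r < m \<Longrightarrow>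
      \<rho>' r = scal s (real (f 0)) \<Longrightarrow> sat s \<rho>' (B r m)"
    and step: "\<And>\<rho>' i' r' r j m. herm_val s \<rho>' \<Longrightarrow> \<forall>i<n. \<rho>' i = \<rho> i \<Longrightarrow> n \<le> m \<Longrightarrow>
      i' < m \<Longrightarrow> r' < m \<Longrightarrow> r < m \<Longrightarrow> j < k \<Longrightarrow>
      \<rho>' i' = scal s (real j) \<Longrightarrow> \<rho>' r' = scal s (real (f j)) \<Longrightarrow> \<rho>' r = scal s (real (f (Suc j))) \<Longrightarrow>
      sat s \<rho>' (S i' r' r m)"
  shows "sat s \<rho> (chain x y n B S)"
proof -
  let ?P = "(\<lambda>j. (real j, real (f j))) ` {..k}"
  have "card ?P \<le> s" using card_image_le[of "{..k}" "\<lambda>j. (real j, real (f j))"] k by simp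
  then obtain M L where herm: "M \<in> herm_mats s" "L \<in> herm_mats s" and P: "joint_spec s M L = ?P"
    using joint_spec_realized[of ?P s] by auto
  let ?\<sigma> = "\<lambda>i r. \<rho>(n := M, n + 1 := L, n + 2 := scal s i, n + 3 := scal s r)"
  let ?\<tau> = "\<lambda>i r i' r'. (?\<sigma> i r)(n + 4 := scal s i', n + 5 := scal s r')"
  have hv1: "herm_val s (\<rho>(n := M, n + 1 := L))" using hv herm by simp
  have hv2: "herm_val s (?\<sigma> i r)" for i r using hv1 by simp
  have hv3: "herm_val s (?\<tau> i r i' r')" for i r i' r' using hv2 by simp
  have mem: "sat s (\<rho>(n := M, n + 1 := L)) (mem_spec x y n (n + 1))"
    using sat_mem_spec[OF hv1, of x k y "f k" n "n + 1"] xy P by auto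
  have "sat s (?\<sigma> i r) (Disj (Neg (mem_spec (n + 2) (n + 3) n (n + 1)))
         (Disj (Conj (num_eq 0 (n + 2)) (B (n + 3) (n + 6)))
            (ex_scal (n + 4) (ex_scal (n + 5) (Conj (mem_spec (n + 4) (n + 5) n (n + 1))
              (Conj (offset_eq 1 (n + 4) (n + 2)) (S (n + 4) (n + 5) (n + 3) (n + 6))))))))"
    (is "sat s _ (Disj (Neg ?mem) (Disj ?base ?step))") for i r
  proof (cases "(i, r) \<in> ?P")
    case False
    then show ?thesis
      using sat_mem_spec[OF hv2, of i r "n + 2" i "n + 3" r n "n + 1"] P by simp
  next
    case True
    then obtain j where j: "j \<le> k" "i = real j" "r = real (f j)" by auto
    show ?thesis
    proof (cases j)
      case 0
      have "sat s (?\<sigma> i r) (num_eq 0 (n + 2))" using sat_num_eq[OF s hv2, of i r "n + 2" i 0] j 0 by simp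
      moreover have "sat s (?\<sigma> i r) (B (n + 3) (n + 6))" by (rule base[OF hv2]) (use j 0 in auto)
      ultimately show ?thesis by simp
    next
      case (Suc l)
      let ?\<rho> = "?\<tau> i r (real l) (real (f l))"
      have "sat s ?\<rho> (mem_spec (n + 4) (n + 5) n (n + 1))"
        using sat_mem_spec[OF hv3, of i r l "f l" "n + 4" l "n + 5" "f l" n "n + 1"] P j Suc by auto
      moreover have "sat s ?\<rho> (offset_eq 1 (n + 4) (n + 2))"
        using sat_offset_eq[OF s hv3, of i r l "f l" "n + 4" l "n + 2" i 1] j Suc by auto
      moreover have "sat s ?\<rho> (S (n + 4) (n + 5) (n + 3) (n + 6))"
        by (rule step[OF hv3, where j = l]) (use j Suc in auto)
      ultimately have "sat s (?\<sigma> i r) ?step" using hv2 by (auto simp: sat_ex_scal)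
      then show ?thesis by simp
    qed
  qed
  then have "sat s (\<rho>(n := M, n + 1 := L))
      (all_scal (n + 2) (all_scal (n + 3) (Disj (Neg ?mem) (Disj ?base ?step))))"
    using hv1 by (simp add: sat_all_scal)
  with herm mem show ?thesis unfolding chain_def Let_def sat.simps by blast
qed

section \<open>Graphs of partial recursive functions\<close>

text \<open>
  The values of the inner functions \<open>Gs\<close> of a composition are bound to the variables \<open>n\<close>, \<open>n + 1\<close>,
  and so on, which are collected in \<open>zs\<close> and finally passed to \<open>F\<close>.
\<close>
primrec bind_args :: "(nat list \<Rightarrow> nat \<Rightarrow> nat \<Rightarrow> formula) list \<Rightarrow> (nat list \<Rightarrow> nat \<Rightarrow> formula) \<Rightarrow>
    nat list \<Rightarrow> nat list \<Rightarrow> nat \<Rightarrow> formula" where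
  "bind_args [] F vs zs n = F zs n"
| "bind_args (G # Gs) F vs zs n =
     ex_scal n (Conj (G vs n (Suc n)) (bind_args Gs F vs (zs @ [n]) (Suc n)))"

text \<open>
  \<open>graph_formula f vs w n\<close> expresses that the program \<open>f\<close> terminates on the values of the variables \<open>vs\<close> with
  the value of \<open>w\<close>. A chain collects the trace of a primitive recursion. For the search operator
  the chain runs through the rejected candidates: its second component at $i + 1$ is the nonzero
  value of \<open>f\<close> at $i$, and at 0, where there is no earlier candidate, it is 0 by convention.
\<close>
primrec graph_formula :: "recf \<Rightarrow> nat list \<Rightarrow> nat \<Rightarrow> nat \<Rightarrow> formula" where
  "graph_formula Zero = (\<lambda>vs w n. num_eq 0 w)"
| "graph_formula Succ = (\<lambda>vs w n. case vs of [v] \<Rightarrow> offset_eq 1 v w | _ \<Rightarrow> falsum w)"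
| "graph_formula (Proj i) = (\<lambda>vs w n. if i < length vs then offset_eq 0 (vs ! i) w else falsum w)"
| "graph_formula (Comp f gs) = (\<lambda>vs w n. bind_args (map graph_formula gs) (\<lambda>zs. graph_formula f zs w) vs [] n)"
| "graph_formula (PrimRec g h) = (\<lambda>vs w n. case vs of [] \<Rightarrow> falsum w
     | v # vs \<Rightarrow> chain v w n (graph_formula g vs) (\<lambda>i' r' r. graph_formula h (i' # r' # vs) r))"
| "graph_formula (Mu f) = (\<lambda>vs w n. ex_scal n (ex_scal (Suc n)
     (Conj (Conj (graph_formula f (w # vs) n (Suc (Suc n))) (num_eq 0 n))
       (chain w (Suc n) (Suc (Suc n)) (\<lambda>r m. num_eq 0 r)
         (\<lambda>i' r' r m. Conj (graph_formula f (i' # vs) r m) (Neg (num_eq 0 r)))))))"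

lemma free_bind_args:
  assumes "\<And>zs m. free_formula (F zs m) \<and> fvars (F zs m) \<subseteq> set zs \<union> {w}"
    and "\<And>G vs w m. G \<in> set Gs \<Longrightarrow> free_formula (G vs w m) \<and> fvars (G vs w m) \<subseteq> set vs \<union> {w}"
  shows "free_formula (bind_args Gs F vs zs n) \<and>
    fvars (bind_args Gs F vs zs n) \<subseteq> set vs \<union> set zs \<union> {w}"
  using assms(2)
proof (induction Gs arbitrary: zs n)
  case Nil
  then show ?case using assms(1)[of zs n] by auto
next
  case (Cons G Gs)
  have "free_formula (bind_args Gs F vs (zs @ [n]) (Suc n)) \<and>
    fvars (bind_args Gs F vs (zs @ [n]) (Suc n)) \<subseteq> set vs \<union> set (zs @ [n]) \<union> {w}"
    by (rule Cons.IH) (use Cons.prems in auto)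
  then show ?case using Cons.prems[of G vs n "Suc n"] by auto
qed

lemma free_graph_formula:
  "free_formula (graph_formula f vs w n) \<and> fvars (graph_formula f vs w n) \<subseteq> set vs \<union> {w}"
proof (induction f arbitrary: vs w n)
  case (Comp f gs)
  have "free_formula (graph_formula (Comp f gs) vs w n) \<and>
    fvars (graph_formula (Comp f gs) vs w n) \<subseteq> set vs \<union> set [] \<union> {w}"
    unfolding graph_formula.simps
  proof (rule free_bind_args)
    show "free_formula (G us z m) \<and> fvars (G us z m) \<subseteq> set us \<union> {z}"
      if "G \<in> set (map graph_formula gs)" for G us z m
    proof -
      from that obtain g where "g \<in> set gs" "G = graph_formula g" by auto
      then show ?thesis using Comp(2)[of g us z m] by simp
    qed
  qed (rule Comp(1))
  then show ?case by simp
next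
  case (PrimRec g h)
  show ?case
  proof (cases vs)
    case (Cons v us)
    have "free_formula (chain v w n (graph_formula g us) (\<lambda>i' r' r. graph_formula h (i' # r' # us) r)) \<and>
      fvars (chain v w n (graph_formula g us) (\<lambda>i' r' r. graph_formula h (i' # r' # us) r)) \<subseteq> set us \<union> {v, w}"
    proof (rule free_chain)
      show "free_formula (graph_formula h (i' # r' # us) r m) \<and>
        fvars (graph_formula h (i' # r' # us) r m) \<subseteq> set us \<union> {i', r', r}" for i' r' r m
        using PrimRec(2)[of "i' # r' # us" r m] by auto
    qed (rule PrimRec(1))
    then show ?thesis by (auto simp: Cons)
  qed simp
next
  case (Mu f)
  let ?S = "\<lambda>i' r' r m. Conj (graph_formula f (i' # vs) r m) (Neg (num_eq 0 r))"
  have "free_formula (chain w (Suc n) (Suc (Suc n)) (\<lambda>r m. num_eq 0 r) ?S) \<and>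
    fvars (chain w (Suc n) (Suc (Suc n)) (\<lambda>r m. num_eq 0 r) ?S) \<subseteq> set vs \<union> {w, Suc n}"
  proof (rule free_chain)
    show "free_formula (?S i' r' r m) \<and> fvars (?S i' r' r m) \<subseteq> set vs \<union> {i', r', r}" for i' r' r m
      using Mu[of "i' # vs" r m] by auto
  qed auto
  then show ?case using Mu[of "w # vs" n "Suc (Suc n)"] by auto
qed (auto split: list.splits)

text \<open>
  The variables \<open>vs\<close> hold the natural numbers \<open>xs\<close> as scalars, and \<open>n\<close> is fresh.
\<close>
definition env :: "nat \<Rightarrow> (nat \<Rightarrow> complex mat) \<Rightarrow> nat list \<Rightarrow> nat list \<Rightarrow> nat \<Rightarrow> bool" where
  "env s \<rho> vs xs n \<longleftrightarrow> map \<rho> vs = map (\<lambda>x. scal s (real x)) xs \<and> (\<forall>v\<in>set vs. v < n)"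

lemma env_Nil [simp]: "env s \<rho> [] [] n"
  by (simp add: env_def)

lemma env_Cons: "env s \<rho> (v # vs) (x # xs) n \<longleftrightarrow> \<rho> v = scal s (real x) \<and> v < n \<and> env s \<rho> vs xs n"
  by (auto simp: env_def)

lemma env_append:
  "env s \<rho> us xs n \<Longrightarrow> env s \<rho> vs ys n \<Longrightarrow> env s \<rho> (us @ vs) (xs @ ys) n"
  by (auto simp: env_def)

lemma env_length: "env s \<rho> vs xs n \<Longrightarrow> length vs = length xs"
  unfolding env_def by (metis length_map)

lemma env_nth: "env s \<rho> vs xs n \<Longrightarrow> i < length xs \<Longrightarrow> \<rho> (vs ! i) = scal s (real (xs ! i))"
  using env_length[of s \<rho> vs xs n] by (auto simp: env_def dest: arg_cong[of _ _ "\<lambda>ys. ys ! i"])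

lemma env_agree:
  assumes "env s \<rho> vs xs n" "\<forall>i<n. \<rho>' i = \<rho> i" "n \<le> m"
  shows "env s \<rho>' vs xs m"
proof -
  have "map \<rho>' vs = map \<rho> vs" using assms by (intro map_cong) (auto simp: env_def)
  then show ?thesis using assms unfolding env_def by (metis less_le_trans)
qed

text \<open>
  The value \<open>t\<close> of the result variable is an arbitrary real number here: that it is natural is part
  of the conclusion, and it is what the search operator needs to turn a nonzero value into a
  successor.
\<close>
definition sound_at :: "nat \<Rightarrow> recf \<Rightarrow> bool" where
  "sound_at s f \<longleftrightarrow> (\<forall>\<rho> vs xs w t n. herm_val s \<rho> \<longrightarrow> env s \<rho> vs xs n \<longrightarrow> w < n \<longrightarrow>
     \<rho> w = scal s t \<longrightarrow> sat s \<rho> (graph_formula f vs w n) \<longrightarrow> (\<exists>y. t = real y \<and> computes f xs y))"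

lemma sound_atD:
  "sound_at s f \<Longrightarrow> herm_val s \<rho> \<Longrightarrow> env s \<rho> vs xs n \<Longrightarrow> w < n \<Longrightarrow> \<rho> w = scal s t \<Longrightarrow>
     sat s \<rho> (graph_formula f vs w n) \<Longrightarrow> \<exists>y. t = real y \<and> computes f xs y"
  unfolding sound_at_def by blast

lemma bind_args_sound:
  assumes "\<And>g. g \<in> set gs \<Longrightarrow> sound_at s g"
    and "herm_val s \<rho>" "env s \<rho> vs xs n" "env s \<rho> zs ks n"
    and "sat s \<rho> (bind_args (map graph_formula gs) F vs zs n)"
  shows "\<exists>\<rho>' ys zs' m. list_all2 (\<lambda>g y. computes g xs y) gs ys \<and> herm_val s \<rho>' \<and>
     (\<forall>i<n. \<rho>' i = \<rho> i) \<and> n \<le> m \<and> env s \<rho>' zs' (ks @ ys) m \<and> sat s \<rho>' (F zs' m)"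
  using assms
proof (induction gs arbitrary: \<rho> zs ks n)
  case Nil
  show ?case
    by (intro exI[of _ \<rho>] exI[of _ "[]"] exI[of _ zs] exI[of _ n]) (use Nil.prems in auto)
next
  case (Cons g gs)
  from Cons.prems obtain t where
    g: "sat s (\<rho>(n := scal s t)) (graph_formula g vs n (Suc n))" and
    rest: "sat s (\<rho>(n := scal s t)) (bind_args (map graph_formula gs) F vs (zs @ [n]) (Suc n))"
    by (auto simp: sat_ex_scal)
  let ?\<rho> = "\<rho>(n := scal s t)"
  have hv: "herm_val s ?\<rho>" using Cons.prems by simp
  have vs: "env s ?\<rho> vs xs (Suc n)" and zs: "env s ?\<rho> zs ks (Suc n)"
    using Cons.prems(3,4) by (auto elim!: env_agree)
  obtain y where y: "t = real y" "computes g xs y"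
    using sound_atD[OF _ hv vs _ _ g] Cons.prems(1) by auto
  have "env s ?\<rho> (zs @ [n]) (ks @ [y]) (Suc n)"
    using zs y by (intro env_append) (auto simp: env_Cons)
  from Cons.IH[OF _ hv vs this rest] Cons.prems(1) obtain \<rho>' ys zs' m where
    "list_all2 (\<lambda>g y. computes g xs y) gs ys" "herm_val s \<rho>'" "\<forall>i<Suc n. \<rho>' i = ?\<rho> i" "Suc n \<le> m"
    "env s \<rho>' zs' ((ks @ [y]) @ ys) m" "sat s \<rho>' (F zs' m)" by auto
  then show ?case using y
    by (intro exI[of _ \<rho>'] exI[of _ "y # ys"] exI[of _ zs'] exI[of _ m]) auto
qed

text \<open>
  Soundness holds at every matrix size, since every named set is finite and a finite set of
  justified pairs contains only true statements about the computation.
\<close>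
lemma graph_formula_sound:
  assumes s: "s \<ge> 1"
  shows "sound_at s f"
proof (induction f)
  case Zero
  show ?case by (auto simp: sound_at_def sat_num_eq[OF s] intro: computes.zero)
next
  case Succ
  have "\<exists>y. t = real y \<and> computes Succ xs y" if "herm_val s \<rho>" "env s \<rho> vs xs n"
    "\<rho> w = scal s t" "sat s \<rho> (graph_formula Succ vs w n)" for \<rho> vs xs w t n
  proof -
    from that(4) obtain v where v: "vs = [v]" by (auto split: list.splits)
    moreover have "length vs = length xs" using that(2) by (rule env_length)
    ultimately obtain x where x: "xs = [x]" using v by (cases xs) auto
    have "t = real (Suc x)" using that v x sat_offset_eq[OF s that(1), of v "real x" w t 1]
      by (auto simp: env_Cons)
    then show ?thesis using x computes.succ by blast
  qed
  then show ?case unfolding sound_at_def by blast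
next
  case (Proj i)
  have "\<exists>y. t = real y \<and> computes (Proj i) xs y" if "herm_val s \<rho>" "env s \<rho> vs xs n"
    "\<rho> w = scal s t" "sat s \<rho> (graph_formula (Proj i) vs w n)" for \<rho> vs xs w t n
  proof -
    from that(4) have i: "i < length xs" "sat s \<rho> (offset_eq 0 (vs ! i) w)"
      using env_length[OF that(2)] by (auto split: if_splits)
    then have "t = real (xs ! i)"
      using that sat_offset_eq[OF s that(1) env_nth[OF that(2) i(1)] that(3), of 0] by auto
    then show ?thesis using i computes.proj by blast
  qed
  then show ?case unfolding sound_at_def by blast
next
  case (Comp f gs)
  have "\<exists>y. t = real y \<and> computes (Comp f gs) xs y" if "herm_val s \<rho>" "env s \<rho> vs xs n" "w < n"
    "\<rho> w = scal s t" "sat s \<rho> (graph_formula (Comp f gs) vs w n)" for \<rho> vs xs w t n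
  proof -
    from bind_args_sound[OF Comp(2) that(1,2) env_Nil, of gs "\<lambda>zs. graph_formula f zs w"] that(5)
    obtain \<rho>' ys zs' m where *: "list_all2 (\<lambda>g y. computes g xs y) gs ys" "herm_val s \<rho>'"
      "\<forall>i<n. \<rho>' i = \<rho> i" "n \<le> m" "env s \<rho>' zs' ys m" "sat s \<rho>' (graph_formula f zs' w m)" by auto
    have w: "w < m" "\<rho>' w = scal s t" using *(3,4) that(3,4) by auto
    obtain y where y: "t = real y" "computes f ys y"
      using sound_atD[OF Comp(1) *(2,5) w *(6)] by auto
    have "computes (Comp f gs) xs y" using *(1) y(2) by (rule computes.comp)
    with y(1) show ?thesis by blast
  qed
  then show ?case unfolding sound_at_def by blast
next
  case (PrimRec g h)
  have "\<exists>y. t = real y \<and> computes (PrimRec g h) xs y" if hv: "herm_val s \<rho>" and env: "env s \<rho> vs xs n"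
    and w: "w < n" "\<rho> w = scal s t" and sat: "sat s \<rho> (graph_formula (PrimRec g h) vs w n)" for \<rho> vs xs w t n
  proof -
    from sat obtain v us where vs: "vs = v # us" by (auto split: list.splits)
    with env_length[OF env] obtain a ks where xs: "xs = a # ks" by (cases xs) auto
    have v: "v < n" "\<rho> v = scal s (real a)" and us: "env s \<rho> us ks n"
      using env by (simp_all add: vs xs env_Cons)
    have ch: "sat s \<rho> (chain v w n (graph_formula g us) (\<lambda>i' r' r. graph_formula h (i' # r' # us) r))"
      using sat by (simp add: vs)
    have "\<exists>k. real a = real k \<and> (\<exists>y. t = real y \<and> computes (PrimRec g h) (k # ks) y)"
    proof (rule chain_sound[OF s hv v(1) w(1) v(2) w(2) ch])
      fix \<rho>' r t m
      assume *: "herm_val s \<rho>'" "\<forall>i<n. \<rho>' i = \<rho> i" "n \<le> m" "r < m" "\<rho>' r = scal s t" "sat s \<rho>' (graph_formula g us r m)"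
      from sound_atD[OF PrimRec(1) *(1) env_agree[OF us *(2,3)] *(4-6)]
      obtain y where "t = real y" "computes g ks y" by auto
      then show "\<exists>y. t = real y \<and> computes (PrimRec g h) (0 # ks) y"
        by (blast intro: computes.primrec_0)
    next
      fix \<rho>' i' r' r k t' t m
      assume *: "herm_val s \<rho>'" "\<forall>i<n. \<rho>' i = \<rho> i" "n \<le> m" "i' < m" "r' < m" "r < m"
        "\<rho>' i' = scal s (real k)" "\<rho>' r' = scal s t'" "\<rho>' r = scal s t" "sat s \<rho>' (graph_formula h (i' # r' # us) r m)"
        and "\<exists>y. t' = real y \<and> computes (PrimRec g h) (k # ks) y"
      then obtain y' where y': "t' = real y'" "computes (PrimRec g h) (k # ks) y'" by blast
      have "env s \<rho>' (i' # r' # us) (k # y' # ks) m"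
        using *(4,5,7,8) y' env_agree[OF us *(2,3)] by (simp add: env_Cons)
      from sound_atD[OF PrimRec(2) *(1) this *(6,9,10)]
      obtain y where "t = real y" "computes h (k # y' # ks) y" by auto
      then show "\<exists>y. t = real y \<and> computes (PrimRec g h) (Suc k # ks) y"
        using y' by (blast intro: computes.primrec_Suc)
    qed
    then show ?thesis by (simp add: xs)
  qed
  then show ?case unfolding sound_at_def by blast
next
  case (Mu f)
  have "\<exists>y. t = real y \<and> computes (Mu f) xs y" if hv: "herm_val s \<rho>" and env: "env s \<rho> vs xs n"
    and w: "w < n" "\<rho> w = scal s t" and sat: "sat s \<rho> (graph_formula (Mu f) vs w n)" for \<rho> vs xs w t n
  proof -
    from sat hv obtain u z where
      f0: "sat s (\<rho>(n := scal s u, Suc n := scal s z)) (graph_formula f (w # vs) n (Suc (Suc n)))" and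
      u: "sat s (\<rho>(n := scal s u, Suc n := scal s z)) (num_eq 0 n)" and
      ch: "sat s (\<rho>(n := scal s u, Suc n := scal s z)) (chain w (Suc n) (Suc (Suc n)) (\<lambda>r m. num_eq 0 r)
         (\<lambda>i' r' r m. Conj (graph_formula f (i' # vs) r m) (Neg (num_eq 0 r))))"
      by (auto simp: sat_ex_scal)
    let ?\<rho> = "\<rho>(n := scal s u, Suc n := scal s z)" and ?n = "Suc (Suc n)"
    have hv': "herm_val s ?\<rho>" using hv by simp
    have env': "env s ?\<rho> vs xs ?n" using env by (auto elim!: env_agree)
    have w': "w < ?n" "?\<rho> w = scal s t" using w by auto
    have "\<exists>k. t = real k \<and> (\<forall>m<k. \<exists>y. computes f (m # xs) (Suc y))"
    proof (rule chain_sound[OF s hv' w'(1) _ w'(2) _ ch])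
      fix \<rho>' i' r' r k t' t m
      assume *: "herm_val s \<rho>'" "\<forall>i<?n. \<rho>' i = ?\<rho> i" "?n \<le> m" "i' < m" "r' < m" "r < m"
        "\<rho>' i' = scal s (real k)" "\<rho>' r' = scal s t'" "\<rho>' r = scal s t"
        "sat s \<rho>' (Conj (graph_formula f (i' # vs) r m) (Neg (num_eq 0 r)))"
        and IH: "\<forall>m<k. \<exists>y. computes f (m # xs) (Suc y)"
      have "env s \<rho>' (i' # vs) (k # xs) m"
        using *(4,7) env_agree[OF env' *(2,3)] by (simp add: env_Cons)
      moreover have "sat s \<rho>' (graph_formula f (i' # vs) r m)" using *(10) by simp
      ultimately obtain y where y: "t = real y" "computes f (k # xs) y"
        using sound_atD[OF Mu *(1) _ *(6,9)] by blast
      moreover have "t \<noteq> 0" using *(10) sat_num_eq[OF s *(1,9), of 0] by simp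
      ultimately obtain y' where "computes f (k # xs) (Suc y')" by (cases y) auto
      then show "\<forall>m<Suc k. \<exists>y. computes f (m # xs) (Suc y)"
        using IH by (auto simp: less_Suc_eq)
    qed auto
    then obtain k where k: "t = real k" "\<forall>m<k. \<exists>y. computes f (m # xs) (Suc y)" by blast
    have "u = 0" using u sat_num_eq[OF s hv', of n u 0] by simp
    moreover have "env s ?\<rho> (w # vs) (k # xs) ?n" using env' w' k by (simp add: env_Cons)
    then have "\<exists>y. u = real y \<and> computes f (k # xs) y"
      using sound_atD[OF Mu hv' _ _ _ f0, of "k # xs" u] by auto
    ultimately have "computes f (k # xs) 0" by auto
    then show ?thesis using k computes.mu[of f k xs] by blast
  qed
  then show ?case unfolding sound_at_def by blast
qed

definition complete_at :: "nat \<Rightarrow> recf \<Rightarrow> nat list \<Rightarrow> nat \<Rightarrow> bool" where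
  "complete_at s f xs y \<longleftrightarrow> (\<forall>\<rho> vs w n. herm_val s \<rho> \<longrightarrow> env s \<rho> vs xs n \<longrightarrow> w < n \<longrightarrow>
     \<rho> w = scal s (real y) \<longrightarrow> sat s \<rho> (graph_formula f vs w n))"

lemma complete_atD:
  "complete_at s f xs y \<Longrightarrow> herm_val s \<rho> \<Longrightarrow> env s \<rho> vs xs n \<Longrightarrow> w < n \<Longrightarrow>
     \<rho> w = scal s (real y) \<Longrightarrow> sat s \<rho> (graph_formula f vs w n)"
  unfolding complete_at_def by blast

lemma bind_args_complete:
  assumes "list_all2 (\<lambda>g y. complete_at s g xs y) gs ys"
    and "herm_val s \<rho>" "env s \<rho> vs xs n" "env s \<rho> zs ks n"
    and "\<And>\<rho>' zs' m. herm_val s \<rho>' \<Longrightarrow> \<forall>i<n. \<rho>' i = \<rho> i \<Longrightarrow> n \<le> m \<Longrightarrow> env s \<rho>' zs' (ks @ ys) m \<Longrightarrow>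
      sat s \<rho>' (F zs' m)"
  shows "sat s \<rho> (bind_args (map graph_formula gs) F vs zs n)"
  using assms
proof (induction gs ys arbitrary: \<rho> zs ks n rule: list_all2_induct)
  case Nil
  show ?case using Nil(4)[of \<rho> n zs] Nil(1-3) by simp
next
  case (Cons g gs y ys)
  let ?\<rho> = "\<rho>(n := scal s (real y))"
  have hv: "herm_val s ?\<rho>" using Cons.prems by simp
  have vs: "env s ?\<rho> vs xs (Suc n)" and zs: "env s ?\<rho> zs ks (Suc n)"
    using Cons.prems(2,3) by (auto elim!: env_agree)
  have "sat s ?\<rho> (graph_formula g vs n (Suc n))" by (rule complete_atD[OF Cons.hyps(1) hv vs]) auto
  moreover have "sat s ?\<rho> (bind_args (map graph_formula gs) F vs (zs @ [n]) (Suc n))"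
  proof (rule Cons.IH[OF hv vs])
    show "env s ?\<rho> (zs @ [n]) (ks @ [y]) (Suc n)"
      using zs by (intro env_append) (auto simp: env_Cons)
    fix \<rho>' zs' m
    assume "herm_val s \<rho>'" "\<forall>i<Suc n. \<rho>' i = ?\<rho> i" "Suc n \<le> m" "env s \<rho>' zs' ((ks @ [y]) @ ys) m"
    then show "sat s \<rho>' (F zs' m)" by (intro Cons.prems(4)) auto
  qed
  ultimately show ?case using Cons.prems(1) by (auto simp: sat_ex_scal)
qed

text \<open>
  Structural induction on the program needs the whole trace of a primitive recursion at once: the
  chain for \<open>k + 1\<close> is not built from the chain for \<open>k\<close>.
\<close>
lemma primrec_trace:
  "computes (PrimRec g h) (k # xs) y \<Longrightarrow> \<exists>r. r k = y \<and> computes g xs (r 0) \<and>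
     (\<forall>i<k. computes h (i # r i # xs) (r (Suc i)))"
proof (induction k arbitrary: y)
  case 0
  then have "computes g xs y" by cases auto
  then show ?case by (intro exI[of _ "\<lambda>_. y"]) simp
next
  case (Suc k)
  from Suc.prems obtain z where z: "computes (PrimRec g h) (k # xs) z" "computes h (k # z # xs) y"
    by cases auto
  from Suc.IH[OF z(1)] obtain r where r: "r k = z" "computes g xs (r 0)"
    "\<forall>i<k. computes h (i # r i # xs) (r (Suc i))" by blast
  show ?case
    by (intro exI[of _ "r(Suc k := y)"]) (use r z in \<open>auto simp: less_Suc_eq\<close>)
qed

text \<open>
  A terminating computation has finitely many subcomputations, so one matrix size is large enough
  for all their traces. Stating this for all large sizes lets the finitely many bounds be merged.
\<close>
lemma graph_formula_complete:
  "computes f xs y \<Longrightarrow> \<forall>\<^sub>F s in sequentially. complete_at s f xs y"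
proof (induction f arbitrary: xs y)
  case Zero
  then have "y = 0" by cases auto
  then have "complete_at s Zero xs y" if "s \<ge> 1" for s
    using that by (simp add: complete_at_def sat_num_eq)
  then show ?case using eventually_ge_at_top[of 1] by (rule eventually_mono[rotated])
next
  case Succ
  then obtain x where x: "xs = [x]" "y = Suc x" by cases auto
  show ?case using eventually_ge_at_top[of 1]
  proof eventually_elim
    case (elim s)
    have "sat s \<rho> (graph_formula Succ vs w n)" if "herm_val s \<rho>" "env s \<rho> vs xs n" "\<rho> w = scal s (real y)"
      for \<rho> vs w n
    proof -
      have "length vs = length xs" using that(2) by (rule env_length)
      then obtain v where v: "vs = [v]" using x by (auto simp: length_Suc_conv)
      then show ?thesis
        using that x sat_offset_eq[OF elim that(1), of v "real x" w "real y" 1] by (auto simp: env_Cons)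
    qed
    then show ?case unfolding complete_at_def by blast
  qed
next
  case (Proj i)
  then have i: "i < length xs" "y = xs ! i" by (cases; simp)+
  show ?case using eventually_ge_at_top[of 1]
  proof eventually_elim
    case (elim s)
    have "sat s \<rho> (graph_formula (Proj i) vs w n)" if "herm_val s \<rho>" "env s \<rho> vs xs n" "\<rho> w = scal s (real y)"
      for \<rho> vs w n
      using sat_offset_eq[OF elim that(1) env_nth[OF that(2) i(1)] that(3), of 0]
        env_length[OF that(2)] i by simp
    then show ?case unfolding complete_at_def by blast
  qed
next
  case (Comp f gs)
  from Comp.prems obtain ys where ys: "list_all2 (\<lambda>g y. computes g xs y) gs ys" "computes f ys y"
    by cases auto
  have "\<forall>\<^sub>F s in sequentially. list_all2 (\<lambda>g y. complete_at s g xs y) gs ys"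
    using ys(1) Comp.IH(2)
  proof (induction rule: list_all2_induct)
    case (Cons g gs y ys)
    then have "\<forall>\<^sub>F s in sequentially. complete_at s g xs y"
      "\<forall>\<^sub>F s in sequentially. list_all2 (\<lambda>g y. complete_at s g xs y) gs ys" by simp_all
    then show ?case by eventually_elim simp
  qed simp
  with Comp.IH(1)[OF ys(2)] show ?case
  proof eventually_elim
    case (elim s)
    have "sat s \<rho> (graph_formula (Comp f gs) vs w n)" if "herm_val s \<rho>" "env s \<rho> vs xs n" "w < n"
      "\<rho> w = scal s (real y)" for \<rho> vs w n
      using bind_args_complete[OF elim(2) that(1,2) env_Nil, of "\<lambda>zs. graph_formula f zs w"]
        complete_atD[OF elim(1)] that(3,4) by auto
    then show ?case unfolding complete_at_def by blast
  qed
next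
  case (PrimRec g h)
  from PrimRec.prems obtain k ks where xs: "xs = k # ks" by cases auto
  from primrec_trace[OF PrimRec.prems[unfolded xs]] obtain r where r: "r k = y"
    "computes g ks (r 0)" "\<And>i. i < k \<Longrightarrow> computes h (i # r i # ks) (r (Suc i))" by blast
  have "\<forall>\<^sub>F s in sequentially. \<forall>i\<in>{..<k}. complete_at s h (i # r i # ks) (r (Suc i))"
    using PrimRec.IH(2) r(3) by (intro eventually_ball_finite) auto
  with PrimRec.IH(1)[OF r(2)] eventually_gt_at_top[of k] show ?case
  proof eventually_elim
    case (elim s)
    have "sat s \<rho> (graph_formula (PrimRec g h) vs w n)" if hv: "herm_val s \<rho>" and env: "env s \<rho> vs xs n"
      and w: "w < n" "\<rho> w = scal s (real y)" for \<rho> vs w n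
    proof -
      obtain v us where vs: "vs = v # us" using env_length[OF env] xs by (cases vs) auto
      have v: "v < n" "\<rho> v = scal s (real k)" and us: "env s \<rho> us ks n"
        using env by (simp_all add: vs xs env_Cons)
      have "sat s \<rho> (chain v w n (graph_formula g us) (\<lambda>i' r' r. graph_formula h (i' # r' # us) r))"
      proof (rule chain_complete[where k = k and f = r, OF _ hv])
        show "sat s \<rho>' (graph_formula g us z m)" if "herm_val s \<rho>'" "\<forall>i<n. \<rho>' i = \<rho> i" "n \<le> m" "z < m"
          "\<rho>' z = scal s (real (r 0))" for \<rho>' z m
          using complete_atD[OF elim(1) that(1) env_agree[OF us that(2,3)] that(4,5)] .
        fix \<rho>' i' r' z j m
        assume *: "herm_val s \<rho>'" "\<forall>i<n. \<rho>' i = \<rho> i" "n \<le> m" "i' < m" "r' < m" "z < m" "j < k"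
          "\<rho>' i' = scal s (real j)" "\<rho>' r' = scal s (real (r j))" "\<rho>' z = scal s (real (r (Suc j)))"
        then have "env s \<rho>' (i' # r' # us) (j # r j # ks) m"
          using env_agree[OF us *(2,3)] by (simp add: env_Cons)
        then show "sat s \<rho>' (graph_formula h (i' # r' # us) z m)"
          using complete_atD[of s h "j # r j # ks" "r (Suc j)"] elim(3) * by auto
      qed (use elim v w r in auto)
      then show ?thesis by (simp add: vs)
    qed
    then show ?case unfolding complete_at_def by blast
  qed
next
  case (Mu f)
  from Mu.prems have f0: "computes f (y # xs) 0" and "\<And>m. m < y \<Longrightarrow> \<exists>z. computes f (m # xs) (Suc z)"
    by (cases; simp)+
  then obtain q where q: "\<And>m. m < y \<Longrightarrow> computes f (m # xs) (Suc (q m))" by metis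
  have "\<forall>\<^sub>F s in sequentially. \<forall>m\<in>{..<y}. complete_at s f (m # xs) (Suc (q m))"
    using Mu.IH q by (intro eventually_ball_finite) auto
  with Mu.IH[OF f0] eventually_gt_at_top[of y] show ?case
  proof eventually_elim
    case (elim s)
    \<comment> \<open>The second components of the chain, shifted by one against the values of \<open>f\<close>.\<close>
    define r where "r j = (case j of 0 \<Rightarrow> 0 | Suc i \<Rightarrow> Suc (q i))" for j
    have "sat s \<rho> (graph_formula (Mu f) vs w n)" if hv: "herm_val s \<rho>" and env: "env s \<rho> vs xs n"
      and w: "w < n" "\<rho> w = scal s (real y)" for \<rho> vs w n
    proof -
      have s: "s \<ge> 1" using elim by simp
      let ?\<rho> = "\<rho>(n := scal s 0, Suc n := scal s (real (r y)))" and ?n = "Suc (Suc n)"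
      have hv': "herm_val s ?\<rho>" using hv by simp
      have env': "env s ?\<rho> vs xs ?n" using env by (auto elim!: env_agree)
      have "env s ?\<rho> (w # vs) (y # xs) ?n" using env' w by (simp add: env_Cons)
      then have "sat s ?\<rho> (graph_formula f (w # vs) n ?n)"
        using complete_atD[OF elim(1) hv'] by simp
      moreover have "sat s ?\<rho> (num_eq 0 n)" using sat_num_eq[OF s hv', of n 0 0] by simp
      moreover have "sat s ?\<rho> (chain w (Suc n) ?n (\<lambda>r m. num_eq 0 r)
         (\<lambda>i' r' r m. Conj (graph_formula f (i' # vs) r m) (Neg (num_eq 0 r))))"
      proof (rule chain_complete[where k = y and f = r, OF s hv'])
        show "sat s \<rho>' (num_eq 0 z)" if "herm_val s \<rho>'" "\<rho>' z = scal s (real (r 0))" for \<rho>' z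
          using sat_num_eq[OF s that, of 0] by (simp add: r_def)
        fix \<rho>' i' r' z j m
        assume *: "herm_val s \<rho>'" "\<forall>i<?n. \<rho>' i = ?\<rho> i" "?n \<le> m" "i' < m" "r' < m" "z < m" "j < y"
          "\<rho>' i' = scal s (real j)" "\<rho>' r' = scal s (real (r j))" "\<rho>' z = scal s (real (r (Suc j)))"
        then have "env s \<rho>' (i' # vs) (j # xs) m"
          using env_agree[OF env' *(2,3)] by (simp add: env_Cons)
        then have "sat s \<rho>' (graph_formula f (i' # vs) z m)"
          using complete_atD[of s f "j # xs" "Suc (q j)"] elim(3) * by (auto simp: r_def)
        moreover have "\<not> sat s \<rho>' (num_eq 0 z)"
          using sat_num_eq[OF s *(1) *(10), of 0] by (simp add: r_def)
        ultimately show "sat s \<rho>' (Conj (graph_formula f (i' # vs) z m) (Neg (num_eq 0 z)))" by simp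
      qed (use elim w in auto)
      ultimately have "sat s ?\<rho> (Conj (Conj (graph_formula f (w # vs) n ?n) (num_eq 0 n))
        (chain w (Suc n) ?n (\<lambda>r m. num_eq 0 r)
         (\<lambda>i' r' r m. Conj (graph_formula f (i' # vs) r m) (Neg (num_eq 0 r)))))" by simp
      then show ?thesis using hv by (auto simp: sat_ex_scal)
    qed
    then show ?case unfolding complete_at_def by blast
  qed
qed

section \<open>Computable codes\<close>

definition unary_recursive :: "(nat \<Rightarrow> nat) \<Rightarrow> bool" where
  "unary_recursive F \<longleftrightarrow> (\<exists>f. \<forall>n. computes f [n] (F n))"

definition recf_add :: recf where
  "recf_add = PrimRec (Proj 0) (Comp Succ [Proj 1])"

definition recf_triangle :: recf where
  "recf_triangle = PrimRec Zero (Comp recf_add [Comp Succ [Proj 0], Proj 1])"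

definition recf_pair :: recf where
  "recf_pair = Comp recf_add [Comp recf_triangle [recf_add], Proj 0]"

lemma computes_proj: "i < length xs \<Longrightarrow> xs ! i = y \<Longrightarrow> computes (Proj i) xs y"
  by (auto intro: computes.proj)

lemma computes_comp1: "computes g xs y \<Longrightarrow> computes f [y] z \<Longrightarrow> computes (Comp f [g]) xs z"
  by (rule computes.comp[where ys = "[y]"]) simp_all

lemma computes_comp2:
  "computes g xs y \<Longrightarrow> computes h xs y' \<Longrightarrow> computes f [y, y'] z \<Longrightarrow> computes (Comp f [g, h]) xs z"
  by (rule computes.comp[where ys = "[y, y']"]) simp_all

lemma computes_add: "computes recf_add [m, n] (m + n)"
  unfolding recf_add_def
proof (induction m)
  case 0
  show ?case by (auto intro!: computes.primrec_0 computes_proj)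
next
  case (Suc m)
  show ?case by (rule computes.primrec_Suc[OF Suc])
    (auto intro!: computes_comp1[of _ _ "m + n"] computes_proj computes.succ)
qed

lemma computes_triangle: "computes recf_triangle [n] (triangle n)"
  unfolding recf_triangle_def
proof (induction n)
  case 0
  show ?case by (auto intro!: computes.primrec_0 computes.zero)
next
  case (Suc n)
  have "computes (Comp recf_add [Comp Succ [Proj 0], Proj 1]) [n, triangle n] (Suc n + triangle n)"
    by (rule computes_comp2[OF _ _ computes_add])
      (auto intro!: computes_comp1[of _ _ n] computes_proj computes.succ)
  then have "computes (Comp recf_add [Comp Succ [Proj 0], Proj 1]) [n, triangle n] (triangle (Suc n))"
    by (simp add: add.commute)
  then show ?case by (rule computes.primrec_Suc[OF Suc])
qed

lemma computes_pair: "computes recf_pair [m, n] (prod_encode (m, n))"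
proof -
  have "computes (Comp recf_triangle [recf_add]) [m, n] (triangle (m + n))"
    by (rule computes_comp1[OF computes_add computes_triangle])
  then have "computes recf_pair [m, n] (triangle (m + n) + m)"
    unfolding recf_pair_def by (rule computes_comp2[OF _ _ computes_add]) (auto intro: computes_proj)
  then show ?thesis by (simp add: prod_encode_def)
qed

lemma unary_recursive_id: "unary_recursive (\<lambda>n. n)"
  unfolding unary_recursive_def by (intro exI[of _ "Proj 0"]) (auto intro: computes_proj)

lemma unary_recursive_Suc: "unary_recursive F \<Longrightarrow> unary_recursive (\<lambda>n. Suc (F n))"
  unfolding unary_recursive_def by (meson computes_comp1 computes.succ)

lemma unary_recursive_const: "unary_recursive (\<lambda>n. k)"
proof (induction k)
  case 0
  show ?case unfolding unary_recursive_def by (meson computes.zero)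
qed (rule unary_recursive_Suc)

lemma unary_recursive_add:
  "unary_recursive F \<Longrightarrow> unary_recursive G \<Longrightarrow> unary_recursive (\<lambda>n. F n + G n)"
  unfolding unary_recursive_def by (meson computes_comp2 computes_add)

lemma unary_recursive_pair:
  "unary_recursive F \<Longrightarrow> unary_recursive G \<Longrightarrow> unary_recursive (\<lambda>n. prod_encode (F n, G n))"
  unfolding unary_recursive_def by (meson computes_comp2 computes_pair)

text \<open>
  The numeral is attached by a conjunct and not substituted for the variable 0. The code of the
  result is therefore obtained from the numeral and the code of \<open>\<phi>\<close> by pairing alone, and no syntactic
  operation on codes has to be computed.
\<close>
definition instantiate :: "nat \<Rightarrow> formula \<Rightarrow> formula" where
  "instantiate n \<phi> = ex_scal 0 (Conj (num_eq n 0) \<phi>)"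

text \<open>
  The signed encoding of integers doubles a nonnegative argument, and the denominator 1 becomes 2.
\<close>
lemma rat_code_of_nat: "rat_code (of_nat n) = prod_encode (n + n, 2)"
proof -
  have "quotient_of (of_nat n) = (int n, 1)"
    by (simp add: of_nat_rat quotient_of_Fract normalize_def)
  then show ?thesis by (simp add: rat_code_def int_encode_def sum_encode_def)
qed

text \<open>
  In the code of \<open>num_eq n x\<close> the number \<open>n\<close> only occurs as the numerator of a coefficient.
\<close>
lemma unary_recursive_num_eq: "unary_recursive (\<lambda>n. formula_code (num_eq n x))"
  unfolding num_eq_def eq0_def formula_code.simps mp_code_def ncp_code_def gr_code_def
    list.map list_encode.simps prod.case fst_conv snd_conv rat_code_of_nat
  by (intro unary_recursive_pair unary_recursive_Suc unary_recursive_add unary_recursive_const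
      unary_recursive_id)

text \<open>
  This is the code of the instantiation of the formula with code \<open>n\<close> at its own code \<open>n\<close>.
\<close>
lemma unary_recursive_diagonal:
  "unary_recursive (\<lambda>n. prod_encode (5, prod_encode (0, prod_encode (3, prod_encode
     (formula_code (is_scalar 0), prod_encode (3, prod_encode (formula_code (num_eq n 0), n)))))))"
  by (intro unary_recursive_pair unary_recursive_const unary_recursive_id unary_recursive_num_eq)

lemma formula_code_instantiate:
  "formula_code (instantiate n \<phi>) = prod_encode (5, prod_encode (0, prod_encode (3, prod_encode
     (formula_code (is_scalar 0), prod_encode (3, prod_encode (formula_code (num_eq n 0), formula_code \<phi>))))))"
  by (simp add: instantiate_def ex_scal_def)

section \<open>Diagonalization\<close>

definition halts_zero :: "recf \<Rightarrow> formula" where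
  "halts_zero f = ex_scal 1 (Conj (num_eq 0 1) (graph_formula f [0] 1 2))"

lemma closed_instantiate_halts_zero: "free_closed_formula (instantiate n (halts_zero f))"
  using free_graph_formula[of f "[0]" 1 2] by (auto simp: free_closed_formula_def instantiate_def halts_zero_def)

lemma sat_instantiate_halts_zero:
  assumes "s \<ge> 1" "herm_val s \<rho>"
  shows "sat s \<rho> (instantiate n (halts_zero f)) \<longleftrightarrow>
    sat s (\<rho>(0 := scal s (real n), 1 := scal s 0)) (graph_formula f [0] 1 2)"
proof -
  have "sat s (\<rho>(0 := scal s t)) (num_eq n 0) \<longleftrightarrow> t = real n" for t
    using sat_num_eq[of s "\<rho>(0 := scal s t)" 0 t n] assms by simp
  moreover have "sat s (\<rho>(0 := scal s t, 1 := scal s u)) (num_eq 0 1) \<longleftrightarrow> u = 0" for t u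
    using sat_num_eq[of s "\<rho>(0 := scal s t, 1 := scal s u)" 1 u 0] assms by simp
  ultimately show ?thesis using assms
    by (simp add: instantiate_def halts_zero_def sat_ex_scal)
qed

text \<open>
  Matrices of some size see exactly the computations that terminate: soundness gives one
  direction at the given size, completeness provides a size for the other.
\<close>
lemma holds_instantiate_halts_zero:
  "(\<exists>s\<ge>1. holds_at s (instantiate n (halts_zero f))) \<longleftrightarrow> computes f [n] 0"
proof
  assume "\<exists>s\<ge>1. holds_at s (instantiate n (halts_zero f))"
  then obtain s where s: "s \<ge> 1" "holds_at s (instantiate n (halts_zero f))" by blast
  let ?\<rho> = "(\<lambda>_. scal s 0)(0 := scal s (real n), 1 := scal s 0)"
  have hv: "herm_val s (\<lambda>_. scal s 0)" by (simp add: herm_val_def)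
  then have "sat s (\<lambda>_. scal s 0) (instantiate n (halts_zero f))"
    using s(2) by (simp add: holds_at_def)
  then have "sat s ?\<rho> (graph_formula f [0] 1 2)"
    unfolding sat_instantiate_halts_zero[OF s(1) hv] .
  moreover have "herm_val s ?\<rho>" using hv by simp
  moreover have "env s ?\<rho> [0] [n] 2" by (simp add: env_Cons)
  ultimately have "\<exists>y. 0 = real y \<and> computes f [n] y"
    using sound_atD[OF graph_formula_sound[OF s(1)], of ?\<rho> "[0]" "[n]" 2 1 0 f] by simp
  then show "computes f [n] 0" by simp
next
  assume "computes f [n] 0"
  from graph_formula_complete[OF this] have "\<forall>\<^sub>F s in sequentially. s \<ge> 1 \<and> complete_at s f [n] 0"
    using eventually_ge_at_top[of 1] by eventually_elim simp
  then obtain s where s: "s \<ge> 1" "complete_at s f [n] 0"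
    by (auto simp: eventually_sequentially)
  have "sat s \<rho> (instantiate n (halts_zero f))" if hv: "herm_val s \<rho>" for \<rho>
    unfolding sat_instantiate_halts_zero[OF s(1) hv]
    by (rule complete_atD[OF s(2)]) (use hv in \<open>auto simp: env_Cons\<close>)
  then show "\<exists>s\<ge>1. holds_at s (instantiate n (halts_zero f))"
    using s(1) by (auto simp: holds_at_def herm_val_def)
qed

text \<open>
  Let \<open>d\<close> compute the code of the self-instantiation of a formula from its code, and let the formula
  \<open>\<psi>\<close> express that \<open>f\<close> after \<open>d\<close> answers 0, which stands for no. Applied to its own code, \<open>\<psi>\<close> holds at some
  matrix size exactly if \<open>f\<close> denies this.
\<close>
lemma no_decider:
  "\<nexists>f. \<forall>\<phi>. free_closed_formula \<phi> \<longrightarrow>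
     computes f [formula_code \<phi>] (of_bool (\<exists>s\<ge>1. holds_at s \<phi>))"
proof
  assume "\<exists>f. \<forall>\<phi>. free_closed_formula \<phi> \<longrightarrow>
     computes f [formula_code \<phi>] (of_bool (\<exists>s\<ge>1. holds_at s \<phi>))"
  then obtain f where f: "\<And>\<phi>. free_closed_formula \<phi> \<Longrightarrow>
     computes f [formula_code \<phi>] (of_bool (\<exists>s\<ge>1. holds_at s \<phi>))" by blast
  obtain d where d: "\<And>\<phi>. computes d [formula_code \<phi>] (formula_code (instantiate (formula_code \<phi>) \<phi>))"
    using unary_recursive_diagonal unfolding unary_recursive_def formula_code_instantiate by blast
  define \<psi> where "\<psi> = halts_zero (Comp f [d])"
  define \<theta> where "\<theta> = instantiate (formula_code \<psi>) \<psi>"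
  let ?b = "\<exists>s\<ge>1. holds_at s \<theta>"
  have "computes f [formula_code \<theta>] (of_bool ?b)"
    by (rule f) (simp add: \<theta>_def \<psi>_def closed_instantiate_halts_zero)
  then have g: "computes (Comp f [d]) [formula_code \<psi>] (of_bool ?b)"
    using d[of \<psi>] unfolding \<theta>_def by (intro computes_comp1)
  have "?b \<longleftrightarrow> computes (Comp f [d]) [formula_code \<psi>] 0"
    unfolding \<theta>_def using holds_instantiate_halts_zero[of "formula_code \<psi>" "Comp f [d]"]
    by (simp add: \<psi>_def)
  also have "\<dots> \<longleftrightarrow> of_bool ?b = (0::nat)"
    using g computes_functional[OF g] by metis
  finally have "?b \<longleftrightarrow> \<not> ?b" by (simp only: of_bool_eq_0_iff)
  then show False by blast
qed

theorem theorem2p1: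
  shows "(\<nexists>f. \<forall>\<phi>. free_closed_formula \<phi> \<longrightarrow>
            computes f [formula_code \<phi>] (of_bool (\<exists>s\<ge>1. holds_at s \<phi>)))
       \<and> \<not> recursive_set
            {formula_code \<phi> | \<phi>. free_closed_formula \<phi> \<and> (\<exists>s\<ge>1. holds_at s \<phi>)}"
proof (intro conjI notI)
  let ?A = "{formula_code \<phi> | \<phi>. free_closed_formula \<phi> \<and> (\<exists>s\<ge>1. holds_at s \<phi>)}"
  assume "recursive_set ?A"
  then obtain f where f: "\<And>n. computes f [n] (of_bool (n \<in> ?A))"
    by (auto simp: recursive_set_def)
  have "computes f [formula_code \<phi>] (of_bool (\<exists>s\<ge>1. holds_at s \<phi>))" if "free_closed_formula \<phi>" for \<phi>
  proof -
    have "formula_code \<phi> \<in> ?A \<longleftrightarrow> (\<exists>s\<ge>1. holds_at s \<phi>)"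
      using that by (auto dest: injD[OF inj_formula_code])
    then show ?thesis using f[of "formula_code \<phi>"] by simp
  qed
  then show False using no_decider by blast
qed (use no_decider in blast)

end
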